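(* Let $\hat z=(\hat x,\hat y,\hat s)$ be formed by the Dual Gambit Rule from $\bar y$ with $\bar\lambda\le\beta<1$. Then $$A\hat x=b,\qquad \|\hat x-\bar x\|_{\bar x}=\|\hat s-\bar s\|_{\bar s}=\bar\lambda\le\beta<1.$$ Hence $\hat x\in\mathrm{int}\,K$, $\hat s\in\mathrm{int}\,K^*$, and $\hat z$ is a strictly feasible primal-dual point, i.e. $\hat z\in\mathrm{rint}\,{\cal F}$.
   Context: $\mathbb E$ is a finite-dimensional real vector space with dual space $\mathbb E^*$; $\langle s,x\rangle$ is the value of $s\in\mathbb E^*$ at $x\in\mathbb E$. $K\subset\mathbb E$ is a closed convex pointed cone with nonempty interior, $K^*=\{s\in\mathbb E^*:\langle s,x\rangle\ge0\ \forall x\in K\}$. A self-concordant function is a closed convex three times differentiable function $f$ with open domain such that $D^3f(x)[h]^3\le 2(D^2f(x)[h]^2)^{3/2}$. $F$ is a $\nu$-normal (regular) barrier for $K$: a self-concordant function with domain $\mathrm{int}\,K$, tending to $+\infty$ at the boundary, with $F(\tau x)=F(x)-\nu\ln\tau$ for $\tau>0$ ($\nu\ge1$). Its dual barrier is $F_*(s)=\max_{x\in\mathrm{int}\,K}[-\langle s,x\rangle-F(x)]$, $s\in\mathrm{int}\,K^*$. $A:\mathbb E\to\mathbb R^m$ is linear with adjoint $A^*:\mathbb R^m\to\mathbb E^*$, $b\in\mathbb R^m\setminus\{0\}$, $c\in\mathbb E^*$; $(A^*,c):\mathbb R^{m+1}\to\mathbb E^*$ is injective, and there exists $(\tilde x,\tilde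 y,\tilde s)\in\mathrm{int}\,K\times\mathbb R^m\times\mathrm{int}\,K^*$ with $A\tilde x=b$, $\tilde s+A^*\tilde y=c$. ${\cal F}={\cal F}_p\times{\cal F}_d$ with ${\cal F}_p=\{x\in K:Ax=b\}$, ${\cal F}_d=\{(y,s):s\in K^*,\ s+A^*y=c\}$; $\mathrm{rint}\,{\cal F}$ consists of those $(x,y,s)\in{\cal F}$ with $x\in\mathrm{int}\,K$, $s\in\mathrm{int}\,K^*$. ${\cal F}_y=\{y\in\mathbb R^m:c-A^*y\in K^*\}$, $\zeta(y)=F_*(c-A^*y)$, $\psi_t(y)=\zeta(y)-t\langle b,y\rangle$. Local norms: $\|u\|_x=\langle\nabla^2F(x)u,u\rangle^{1/2}$ for $u\in\mathbb E$, $x\in\mathrm{int}\,K$; $\|g\|_s=\langle g,\nabla^2F_*(s)g\rangle^{1/2}$ for $g\in\mathbb E^*$, $s\in\mathrm{int}\,K^*$. Dual Gambit Rule. Let $t>0$ and $\bar y\in\mathrm{int}\,{\cal F}_y$ with $\bar\lambda:=\langle\nabla\psi_t(\bar y),[\nabla^2\zeta(\bar y)]^{-1}\nabla\psi_t(\bar y)\rangle^{1/2}\le\beta<1$. Put $\bar d=[\nabla^2\zeta(\bar y)]^{-1}\nabla\psi_t(\bar y)$, $\bar s=c-A^*\bar y$, $\bar x=-\frac1t\nabla F_*(\bar s)$, $\hat y=\bar y+\bar d$, $\hat s=c-A^*\hat y$, $\bar w_*=\sqrt t\,\bar s$, $\hat x=\nabla^2F_*(\bar w_* )\hat s$, $\hat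 z=(\hat x,\hat y,\hat s)$. *)

theory Defs
  imports "HOL-Analysis.Analysis"
begin

text \<open>
  The dual of a finite-dimensional space \<open>'a\<close> is the type \<open>'a \<Rightarrow>\<^sub>L real\<close>, with \<open>\<langle>s, x\<rangle>\<close> written as
  application. The inner product of \<open>'a\<close> is never used to identify \<open>'a\<close> with its dual.
  On \<open>real ^ 'm\<close> gradients are functionals as well and Hessians map into functionals, so that
  \<open>\<langle>g, H\<^sup>-\<^sup>1 g\<rangle>\<close> does not depend on whether \<open>real ^ 'm\<close> is identified with its dual.
\<close>

definition fderiv :: "('v::real_normed_vector \<Rightarrow> 'w::real_normed_vector) \<Rightarrow> 'v \<Rightarrow> ('v \<Rightarrow>\<^sub>L 'w)"
  where "fderiv f x = Blinfun (frechet_derivative f (at x))"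

abbreviation hessian ::
    "('v::real_normed_vector \<Rightarrow> real) \<Rightarrow> 'v \<Rightarrow> ('v \<Rightarrow>\<^sub>L 'v \<Rightarrow>\<^sub>L real)"
  where "hessian f \<equiv> fderiv (fderiv f)"

text \<open>The canonical identification of the bidual of a finite-dimensional space with the space.\<close>

definition of_bidual :: "(('a::euclidean_space \<Rightarrow>\<^sub>L real) \<Rightarrow>\<^sub>L real) \<Rightarrow> 'a"
  where "of_bidual \<phi> = (THE x. \<forall>s. blinfun_apply \<phi> s = blinfun_apply s x)"

definition dual_grad ::
    "(('a::euclidean_space \<Rightarrow>\<^sub>L real) \<Rightarrow> real) \<Rightarrow> ('a \<Rightarrow>\<^sub>L real) \<Rightarrow> 'a"
  where "dual_grad G s = of_bidual (fderiv G s)"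

definition dual_hessian ::
    "(('a::euclidean_space \<Rightarrow>\<^sub>L real) \<Rightarrow> real) \<Rightarrow> ('a \<Rightarrow>\<^sub>L real) \<Rightarrow> ('a \<Rightarrow>\<^sub>L real) \<Rightarrow> 'a"
  where "dual_hessian G s g = of_bidual (blinfun_apply (hessian G s) g)"

definition dual_cone :: "'a::real_normed_vector set \<Rightarrow> ('a \<Rightarrow>\<^sub>L real) set"
  where "dual_cone K = {s. \<forall>x\<in>K. 0 \<le> blinfun_apply s x}"

definition pointed :: "'a::real_vector set \<Rightarrow> bool"
  where "pointed K \<longleftrightarrow> (\<forall>x. x \<in> K \<and> - x \<in> K \<longrightarrow> x = 0)"

text \<open>
  The domain of a function is given as a separate set \<open>D\<close>; values outside \<open>D\<close> are irrelevant.
  A closed function is one whose epigraph over its domain is closed.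
\<close>

definition self_concordant_on :: "'v::real_normed_vector set \<Rightarrow> ('v \<Rightarrow> real) \<Rightarrow> bool"
  where "self_concordant_on D f \<longleftrightarrow>
    open D \<and> convex_on D f \<and> closed {(x, r). x \<in> D \<and> f x \<le> r} \<and>
    (\<forall>x\<in>D. f differentiable (at x) \<and> fderiv f differentiable (at x) \<and>
           hessian f differentiable (at x)) \<and>
    (\<forall>x\<in>D. \<forall>h. blinfun_apply (blinfun_apply (blinfun_apply (fderiv (hessian f) x) h) h) h
                \<le> 2 * (blinfun_apply (blinfun_apply (hessian f x) h) h) powr (3 / 2))"

definition normal_barrier :: "'v::real_normed_vector set \<Rightarrow> real \<Rightarrow> ('v \<Rightarrow> real) \<Rightarrow> bool"
  where "normal_barrier K \<nu> F \<longleftrightarrow>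
    \<nu> \<ge> 1 \<and> self_concordant_on (interior K) F \<and>
    (\<forall>z\<in>frontier K. filterlim F at_top (at z within interior K)) \<and>
    (\<forall>x\<in>interior K. \<forall>\<tau>>0. F (\<tau> *\<^sub>R x) = F x - \<nu> * ln \<tau>)"

definition dual_barrier ::
    "'a::real_normed_vector set \<Rightarrow> ('a \<Rightarrow> real) \<Rightarrow> ('a \<Rightarrow>\<^sub>L real) \<Rightarrow> real"
  where "dual_barrier K F s =
    (GREATEST v. v \<in> (\<lambda>x. - blinfun_apply s x - F x) ` interior K)"

definition primal_local_norm :: "('a::real_normed_vector \<Rightarrow> real) \<Rightarrow> 'a \<Rightarrow> 'a \<Rightarrow> real"
  where "primal_local_norm F x u = sqrt (blinfun_apply (blinfun_apply (hessian F x) u) u)"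

definition dual_local_norm ::
    "(('a::euclidean_space \<Rightarrow>\<^sub>L real) \<Rightarrow> real) \<Rightarrow> ('a \<Rightarrow>\<^sub>L real) \<Rightarrow> ('a \<Rightarrow>\<^sub>L real) \<Rightarrow> real"
  where "dual_local_norm G s g = sqrt (blinfun_apply g (dual_hessian G s g))"

definition adj_map :: "('a::euclidean_space \<Rightarrow> real ^ 'm) \<Rightarrow> real ^ 'm \<Rightarrow> ('a \<Rightarrow>\<^sub>L real)"
  where "adj_map A y = Blinfun (\<lambda>x. y \<bullet> A x)"

definition primal_feasible :: "'a set \<Rightarrow> ('a::euclidean_space \<Rightarrow> real ^ 'm) \<Rightarrow> real ^ 'm \<Rightarrow> 'a set"
  where "primal_feasible K A b = {x \<in> K. A x = b}"

definition dual_feasible ::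
    "'a set \<Rightarrow> ('a::euclidean_space \<Rightarrow> real ^ 'm) \<Rightarrow> ('a \<Rightarrow>\<^sub>L real) \<Rightarrow> ((real ^ 'm) \<times> ('a \<Rightarrow>\<^sub>L real)) set"
  where "dual_feasible K A c = {(y, s). s \<in> dual_cone K \<and> s + adj_map A y = c}"

definition feasible ::
    "'a set \<Rightarrow> ('a::euclidean_space \<Rightarrow> real ^ 'm) \<Rightarrow> real ^ 'm \<Rightarrow> ('a \<Rightarrow>\<^sub>L real) \<Rightarrow>
     ('a \<times> (real ^ 'm) \<times> ('a \<Rightarrow>\<^sub>L real)) set"
  where "feasible K A b c = primal_feasible K A b \<times> dual_feasible K A c"

definition rint_feasible ::
    "'a set \<Rightarrow> ('a::euclidean_space \<Rightarrow> real ^ 'm) \<Rightarrow> real ^ 'm \<Rightarrow> ('a \<Rightarrow>\<^sub>L real) \<Rightarrow>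
     ('a \<times> (real ^ 'm) \<times> ('a \<Rightarrow>\<^sub>L real)) set"
  where "rint_feasible K A b c =
    {(x, y, s) \<in> feasible K A b c. x \<in> interior K \<and> s \<in> interior (dual_cone K)}"

definition feasible_y ::
    "'a set \<Rightarrow> ('a::euclidean_space \<Rightarrow> real ^ 'm) \<Rightarrow> ('a \<Rightarrow>\<^sub>L real) \<Rightarrow> (real ^ 'm) set"
  where "feasible_y K A c = {y. c - adj_map A y \<in> dual_cone K}"

definition zeta ::
    "'a set \<Rightarrow> ('a::euclidean_space \<Rightarrow> real) \<Rightarrow> ('a \<Rightarrow> real ^ 'm) \<Rightarrow> ('a \<Rightarrow>\<^sub>L real) \<Rightarrow>
     real ^ 'm \<Rightarrow> real"
  where "zeta K F A c y = dual_barrier K F (c - adj_map A y)"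

definition psi ::
    "'a set \<Rightarrow> ('a::euclidean_space \<Rightarrow> real) \<Rightarrow> ('a \<Rightarrow> real ^ 'm) \<Rightarrow> real ^ 'm \<Rightarrow> ('a \<Rightarrow>\<^sub>L real) \<Rightarrow>
     real \<Rightarrow> real ^ 'm \<Rightarrow> real"
  where "psi K F A b c t y = zeta K F A c y - t * (b \<bullet> y)"

text \<open>The sign is \<open>+\<close>: the gambit direction is the negative of the Newton step for minimising \<open>\<psi>\<^sub>t\<close>.\<close>

definition gambit_direction ::
    "'a set \<Rightarrow> ('a::euclidean_space \<Rightarrow> real) \<Rightarrow> ('a \<Rightarrow> real ^ 'm) \<Rightarrow> real ^ 'm \<Rightarrow> ('a \<Rightarrow>\<^sub>L real) \<Rightarrow>
     real \<Rightarrow> real ^ 'm \<Rightarrow> real ^ 'm"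
  where "gambit_direction K F A b c t y =
    inv (blinfun_apply (hessian (zeta K F A c) y)) (fderiv (psi K F A b c t) y)"

definition newton_decrement ::
    "'a set \<Rightarrow> ('a::euclidean_space \<Rightarrow> real) \<Rightarrow> ('a \<Rightarrow> real ^ 'm) \<Rightarrow> real ^ 'm \<Rightarrow> ('a \<Rightarrow>\<^sub>L real) \<Rightarrow>
     real \<Rightarrow> real ^ 'm \<Rightarrow> real"
  where "newton_decrement K F A b c t y =
    sqrt (blinfun_apply (fderiv (psi K F A b c t) y) (gambit_direction K F A b c t y))"

end

theory Submission
  imports Defs
begin

text \<open>
  The Hessian of the dual barrier at a point \<open>s = - DF(x)\<close> is the inverse of \<open>\<nabla>\<^sup>2F(x)\<close>, so every quantity
  of the rule can be expressed through the single point \<open>x\<close> with \<open>- DF(x) = sbar\<close>. Put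
  \<open>a = A\<^sup>* dbar\<close> and \<open>v = [\<nabla>\<^sup>2F(x)]\<^sup>-\<^sup>1 a\<close>. The Newton system for \<open>dbar\<close> becomes \<open>A v = A x - t b\<close>
  (\<open>gambit_direction_equation\<close>). By homogeneity \<open>xbar = x / t\<close>, and Euler's relation
  \<open>\<nabla>\<^sup>2F(x) x = - DF(x)\<close> yields \<open>xhat = (x - v) / t\<close>. Hence \<open>A xhat = b\<close>, and the displacements
  \<open>xhat - xbar = - v / t\<close> and \<open>shat - sbar = - a\<close> both have squared local length \<open>\<langle>a, v\<rangle>\<close>, which is
  also the square of the Newton decrement.

  It remains to see that a displacement of local length less than 1 stays in the interior of the cone.
  On the primal side this is the Dikin ellipsoid theorem for self-concordant functions
  (\<open>Dikin_ellipsoid\<close>), which in a pointed cone also implies that the Hessian is definite. On the dual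
  side (\<open>dual_Dikin_ellipsoid\<close>) self-concordance of the dual barrier is avoided: it suffices that
  \<open>\<parallel>u\<parallel>\<^sub>x \<le> \<langle>- DF(x), u\<rangle>\<close> for \<open>u\<close> in \<open>K\<close> (\<open>local_norm_le_neg_gradient\<close>), together with the
  Cauchy-Schwarz inequality for the symmetric form \<open>\<nabla>\<^sup>2F(x)\<close>. Both rest on one estimate: along a line, the
  reciprocal of the local norm of the direction is 1-Lipschitz (\<open>inverse_local_norm_Lipschitz\<close>).

  The calculus of the dual barrier rests on the map \<open>x \<mapsto> - DF(x)\<close> from the interior of \<open>K\<close>. It is
  injective as the Hessian is definite, its image contains the interior of the dual cone
  (\<open>gradient_attains_dual\<close>), and the inverse function theorem differentiates its inverse
  (\<open>deriv_dual_point\<close>).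
\<close>

section \<open>Derivatives as bounded linear maps, and the dual space\<close>

lemma fderiv_eqI:
  assumes "(f has_derivative blinfun_apply L) (at x)"
  shows "fderiv f x = L"
  by (simp add: fderiv_def frechet_derivative_at[OF assms, symmetric] blinfun_apply_inverse)

lemma has_derivative_fderiv:
  assumes "f differentiable (at x)"
  shows "(f has_derivative blinfun_apply (fderiv f x)) (at x)"
proof -
  have "(f has_derivative frechet_derivative f (at x)) (at x)"
    using assms by (simp add: frechet_derivative_works)
  moreover from this have "blinfun_apply (fderiv f x) = frechet_derivative f (at x)"
    unfolding fderiv_def
    by (intro bounded_linear_Blinfun_apply has_derivative_bounded_linear)
  ultimately show ?thesis by simp
qed

lemma fderiv_apply_eqI:
  assumes "(f has_derivative f') (at x)"
  shows "blinfun_apply (fderiv f x) h = f' h"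
  using has_derivative_unique[OF has_derivative_fderiv[OF differentiableI[OF assms]] assms] by simp

lemma has_derivative_apply:
  assumes "(f has_derivative f') F"
  shows "((\<lambda>x. blinfun_apply (f x) u) has_derivative (\<lambda>h. blinfun_apply (f' h) u)) F"
  by (rule bounded_linear.has_derivative[OF _ assms]) (rule blinfun.bounded_linear_left)

lemma has_derivative_scaled:
  assumes "(g has_derivative g') (at (\<tau> *\<^sub>R x))"
  shows "((\<lambda>y. g (\<tau> *\<^sub>R y)) has_derivative (\<lambda>h. g' (\<tau> *\<^sub>R h))) (at x)"
  by (rule has_derivative_compose[where g = g and f = "(*\<^sub>R) \<tau>"])
    (auto intro!: derivative_eq_intros assms)

lemma DERIV_along_line:
  fixes f :: "'v::real_normed_vector \<Rightarrow> real"
  assumes "(f has_derivative f') (at (x + t *\<^sub>R h))"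
  shows "((\<lambda>\<tau>. f (x + \<tau> *\<^sub>R h)) has_real_derivative f' h) (at t)"
proof -
  have "((\<lambda>\<tau>. x + \<tau> *\<^sub>R h) has_derivative (\<lambda>\<tau>. \<tau> *\<^sub>R h)) (at t)"
    by (auto intro!: derivative_eq_intros)
  from has_derivative_compose[OF this assms] 
  have "((\<lambda>\<tau>. f (x + \<tau> *\<^sub>R h)) has_derivative (\<lambda>\<tau>. f' (\<tau> *\<^sub>R h))) (at t)" .
  moreover have "f' (\<tau> *\<^sub>R h) = f' h * \<tau>" for \<tau>
    using linear_cmul[OF has_derivative_linear[OF assms]] by simp
  ultimately show ?thesis
    by (simp add: has_field_derivative_def)
qed

text \<open>
  The Euclidean representative of a functional. It only transports statements about linear maps and
  inverse functions from \<open>'a \<Rightarrow> 'a\<close> to maps between the space and its dual.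
\<close>

definition riesz :: "('a::euclidean_space \<Rightarrow>\<^sub>L real) \<Rightarrow> 'a"
  where "riesz s = (\<Sum>b\<in>Basis. blinfun_apply s b *\<^sub>R b)"

lemma inner_riesz: "riesz s \<bullet> x = blinfun_apply s x"
proof -
  have "blinfun_apply s x = blinfun_apply s (\<Sum>b\<in>Basis. (x \<bullet> b) *\<^sub>R b)"
    by (simp add: euclidean_representation)
  also have "\<dots> = (\<Sum>b\<in>Basis. (x \<bullet> b) * blinfun_apply s b)"
    by (simp add: blinfun.bilinear_simps)
  also have "\<dots> = riesz s \<bullet> x"
    unfolding riesz_def inner_sum_left
    by (rule sum.cong) (auto simp: inner_commute)
  finally show ?thesis by simp
qed

lemma blinfun_inner_right_riesz [simp]: "blinfun_inner_right (riesz s) = s"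
  by (rule blinfun_eqI) (simp add: inner_riesz)

lemma riesz_blinfun_inner_right [simp]: "riesz (blinfun_inner_right x) = x"
  by (rule vector_eq_rdot[THEN iffD1]) (simp add: inner_riesz)

lemma bounded_linear_riesz: "bounded_linear riesz"
  unfolding riesz_def
  by (intro bounded_linear_sum bounded_linear_scaleR_const) (rule blinfun.bounded_linear_left)

text \<open>
  Newton systems are solvable because a definite form is injective as a map into the dual, and
  source and target have the same dimension.
\<close>

lemma positive_form_bij:
  fixes L :: "'a::euclidean_space \<Rightarrow>\<^sub>L 'a \<Rightarrow>\<^sub>L real"
  assumes "\<And>u. L u u = 0 \<Longrightarrow> u = 0"
  shows "bij (blinfun_apply L)"
proof -
  have inj: "inj (blinfun_apply L)"
    by (rule injI) (metis assms blinfun.diff_left blinfun.diff_right eq_iff_diff_eq_0 zero_blinfun.rep_eq)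
  have lin: "linear (\<lambda>u. riesz (L u))"
    by (intro bounded_linear.linear bounded_linear_compose[OF bounded_linear_riesz] blinfun.bounded_linear_right)
  have "inj (\<lambda>u. riesz (L u))"
    using inj by (metis (no_types, lifting) blinfun_inner_right_riesz inj_def)
  then have "surj (\<lambda>u. riesz (L u))"
    using lin linear_injective_imp_surjective by blast
  then have "surj (blinfun_apply L)"
    by (metis (no_types, lifting) blinfun_inner_right_riesz surj_def)
  with inj show ?thesis by (simp add: bij_def)
qed

lemma of_bidual_eqI:
  assumes "\<And>s. blinfun_apply \<phi> s = blinfun_apply s x"
  shows "of_bidual \<phi> = x"
  unfolding of_bidual_def
proof (rule the_equality)
  fix y assume "\<forall>s. blinfun_apply \<phi> s = blinfun_apply s y"
  then have "blinfun_inner_right z y = blinfun_inner_right z x" for z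
    using assms by metis
  then show "y = x" by (intro vector_eq_ldot[THEN iffD1]) simp
qed (simp add: assms)

lift_definition to_bidual :: "'a::real_normed_vector \<Rightarrow> ('a \<Rightarrow>\<^sub>L real) \<Rightarrow>\<^sub>L real"
  is "\<lambda>x s. blinfun_apply s x"
  by (rule blinfun.bounded_linear_left)

lemma bounded_linear_to_bidual: "bounded_linear to_bidual"
proof (rule bounded_linear_intro[where K = 1])
  fix x :: 'a
  show "norm (to_bidual x) \<le> norm x * 1"
    by (rule norm_blinfun_bound) (use norm_blinfun[where x = x] in \<open>auto simp: to_bidual.rep_eq mult.commute simp flip: real_norm_def\<close>)
qed (rule blinfun_eqI; simp add: to_bidual.rep_eq blinfun.bilinear_simps)+

lemma of_bidual_to_bidual [simp]: "of_bidual (to_bidual x) = x"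
  by (rule of_bidual_eqI) (simp add: to_bidual.rep_eq)

lemma adj_map_apply:
  fixes A :: "'a::euclidean_space \<Rightarrow> real ^ 'm"
  assumes "linear A"
  shows "blinfun_apply (adj_map A y) x = y \<bullet> A x"
proof -
  have "bounded_linear (\<lambda>x. y \<bullet> A x)"
    using assms by (intro bounded_linear_inner_right_comp) (simp add: linear_conv_bounded_linear)
  then show ?thesis
    by (simp add: adj_map_def bounded_linear_Blinfun_apply)
qed

lemma bounded_linear_adj_map:
  fixes A :: "'a::euclidean_space \<Rightarrow> real ^ 'm"
  assumes "linear A"
  shows "bounded_linear (adj_map A)"
proof -
  have "linear (adj_map A)"
    by (rule linearI; rule blinfun_eqI)
      (simp_all add: adj_map_apply[OF assms] blinfun.bilinear_simps inner_add_left)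
  then show ?thesis by (simp add: linear_conv_bounded_linear)
qed

text \<open>
  The mean value theorem is used twice: for the increment of \<open>f\<close> in direction \<open>v\<close> as a function of
  the step along \<open>u\<close>, and then for the gradient along \<open>v\<close>. Exchanging \<open>u\<close> and \<open>v\<close> leaves the second
  difference unchanged, so in the limit it yields the symmetry of the second derivative.
\<close>

lemma second_difference_MVT:
  fixes f :: "'v::real_normed_vector \<Rightarrow> real"
  assumes e: "e > 0" and t: "0 < t" "t * (norm u + norm v) < e"
    and d1: "\<And>y. y \<in> ball x e \<Longrightarrow> (f has_derivative blinfun_apply (g y)) (at y)"
    and d2: "\<And>y. y \<in> ball x e \<Longrightarrow> (g has_derivative blinfun_apply (H y)) (at y)"
  shows "\<exists>p. norm (p - x) \<le> t * (norm u + norm v) \<and>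
     f (x + t *\<^sub>R u + t *\<^sub>R v) - f (x + t *\<^sub>R u) - f (x + t *\<^sub>R v) + f x = t\<^sup>2 * H p v u"
proof -
  have nrm: "norm (\<sigma> *\<^sub>R u + \<tau> *\<^sub>R v) \<le> t * (norm u + norm v)"
    if "0 \<le> \<sigma>" "\<sigma> \<le> t" "0 \<le> \<tau>" "\<tau> \<le> t" for \<sigma> \<tau>
  proof -
    have "norm (\<sigma> *\<^sub>R u + \<tau> *\<^sub>R v) \<le> \<sigma> * norm u + \<tau> * norm v"
      using that by (metis abs_of_nonneg norm_scaleR norm_triangle_ineq)
    also have "\<dots> \<le> t * norm u + t * norm v"
      using that by (intro add_mono mult_right_mono) auto
    finally show ?thesis by (simp add: distrib_left)
  qed
  have ball: "x + \<sigma> *\<^sub>R u + \<tau> *\<^sub>R v \<in> ball x e"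
    if "0 \<le> \<sigma>" "\<sigma> \<le> t" "0 \<le> \<tau>" "\<tau> \<le> t" for \<sigma> \<tau>
  proof -
    have "dist x (x + \<sigma> *\<^sub>R u + \<tau> *\<^sub>R v) = norm (\<sigma> *\<^sub>R u + \<tau> *\<^sub>R v)"
      by (metis add.assoc add_diff_cancel_left' dist_commute dist_norm)
    then show ?thesis using nrm[OF that] t(2) by simp
  qed
  let ?G = "\<lambda>\<sigma>. f (x + t *\<^sub>R v + \<sigma> *\<^sub>R u) - f (x + \<sigma> *\<^sub>R u)"
  have DG: "(?G has_real_derivative g (x + t *\<^sub>R v + \<sigma> *\<^sub>R u) u - g (x + \<sigma> *\<^sub>R u) u) (at \<sigma>)"
    if "0 \<le> \<sigma>" "\<sigma> \<le> t" for \<sigma>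
  proof (rule DERIV_diff)
    show "((\<lambda>\<sigma>. f (x + t *\<^sub>R v + \<sigma> *\<^sub>R u)) has_real_derivative g (x + t *\<^sub>R v + \<sigma> *\<^sub>R u) u) (at \<sigma>)"
      using ball[of \<sigma> t] that t
      by (intro DERIV_along_line[OF d1]) (simp add: add.assoc add.commute[of "t *\<^sub>R v"])
    show "((\<lambda>\<sigma>. f (x + \<sigma> *\<^sub>R u)) has_real_derivative g (x + \<sigma> *\<^sub>R u) u) (at \<sigma>)"
      using ball[of \<sigma> 0] that t by (intro DERIV_along_line[OF d1]) simp
  qed
  obtain \<sigma> where \<sigma>: "0 < \<sigma>" "\<sigma> < t" 
    and G: "?G t - ?G 0 = (t - 0) * (g (x + t *\<^sub>R v + \<sigma> *\<^sub>R u) u - g (x + \<sigma> *\<^sub>R u) u)"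
    using MVT2[OF t(1), of ?G "\<lambda>\<sigma>. g (x + t *\<^sub>R v + \<sigma> *\<^sub>R u) u - g (x + \<sigma> *\<^sub>R u) u"] DG by blast
  have Dg: "((\<lambda>\<tau>. g (x + \<sigma> *\<^sub>R u + \<tau> *\<^sub>R v) u) has_real_derivative H (x + \<sigma> *\<^sub>R u + \<tau> *\<^sub>R v) v u) (at \<tau>)"
    if "0 \<le> \<tau>" "\<tau> \<le> t" for \<tau>
    by (rule DERIV_along_line[OF has_derivative_apply[OF d2]]) (use ball[of \<sigma> \<tau>] that \<sigma> in auto)
  obtain \<tau> where \<tau>: "0 < \<tau>" "\<tau> < t"
    and "g (x + \<sigma> *\<^sub>R u + t *\<^sub>R v) u - g (x + \<sigma> *\<^sub>R u + 0 *\<^sub>R v) u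
       = (t - 0) * H (x + \<sigma> *\<^sub>R u + \<tau> *\<^sub>R v) v u"
    using MVT2[OF t(1), of "\<lambda>\<tau>. g (x + \<sigma> *\<^sub>R u + \<tau> *\<^sub>R v) u"
        "\<lambda>\<tau>. H (x + \<sigma> *\<^sub>R u + \<tau> *\<^sub>R v) v u"] Dg by blast
  then show ?thesis
    using G nrm[of \<sigma> \<tau>] \<sigma>
    by (intro exI[of _ "x + \<sigma> *\<^sub>R u + \<tau> *\<^sub>R v"])
      (simp add: power2_eq_square algebra_simps)
qed

lemma second_derivative_symmetric:
  fixes f :: "'v::real_normed_vector \<Rightarrow> real"
  assumes e: "e > 0"
    and d1: "\<And>y. y \<in> ball x e \<Longrightarrow> (f has_derivative blinfun_apply (g y)) (at y)"
    and d2: "\<And>y. y \<in> ball x e \<Longrightarrow> (g has_derivative blinfun_apply (H y)) (at y)"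
    and cont: "isCont H x"
  shows "H x u v = H x v u"
proof -
  define M where "M = norm u + norm v + 1"
  have M: "M > 0" "norm u + norm v < M"
    by (auto simp: M_def add_nonneg_pos)
  \<comment> \<open>Step lengths that tend to 0 and keep the whole parallelogram inside the ball.\<close>
  define T where "T n = e / (M * real (Suc n))" for n
  have T: "T n > 0" "T n * (norm u + norm v) < e" for n
  proof -
    show "T n > 0" using e M by (simp add: T_def)
    then have "T n * (norm u + norm v) < T n * M"
      using M(2) by simp
    also have "\<dots> = e / real (Suc n)" using M by (simp add: T_def)
    also have "\<dots> \<le> e" using e by (simp add: field_simps)
    finally show "T n * (norm u + norm v) < e" .
  qed
  have lim: "(\<lambda>n. T n * (norm u + norm v)) \<longlonglongrightarrow> 0"
  proof -
    have "(\<lambda>n. e / M * (norm u + norm v) * inverse (real (Suc n))) \<longlonglongrightarrow> e / M * (norm u + norm v) * 0"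
      by (intro tendsto_mult tendsto_const LIMSEQ_inverse_real_of_nat)
    then show ?thesis by (simp add: T_def field_simps)
  qed
  have lims: "(\<lambda>n. H (p n) a b) \<longlonglongrightarrow> H x a b"
    if "\<And>n. norm (p n - x) \<le> T n * (norm u + norm v)" for p a b
  proof -
    have "(\<lambda>n. p n - x) \<longlonglongrightarrow> 0"
      by (rule Lim_null_comparison[OF _ lim]) (use that in auto)
    then have "p \<longlonglongrightarrow> x" by (simp add: LIM_zero_iff)
    then have "(\<lambda>n. H (p n)) \<longlonglongrightarrow> H x"
      using cont isCont_tendsto_compose by blast
    then show ?thesis by (intro tendsto_intros)
  qed
  have "\<forall>n. \<exists>p. norm (p - x) \<le> T n * (norm u + norm v) \<and>
     f (x + T n *\<^sub>R u + T n *\<^sub>R v) - f (x + T n *\<^sub>R u) - f (x + T n *\<^sub>R v) + f x = (T n)\<^sup>2 * H p v u"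
    using second_difference_MVT[OF e T d1 d2] by blast
  then obtain p where p: "\<And>n. norm (p n - x) \<le> T n * (norm u + norm v)"
    "\<And>n. f (x + T n *\<^sub>R u + T n *\<^sub>R v) - f (x + T n *\<^sub>R u) - f (x + T n *\<^sub>R v) + f x
       = (T n)\<^sup>2 * H (p n) v u" by metis
  have "\<forall>n. \<exists>q. norm (q - x) \<le> T n * (norm v + norm u) \<and>
     f (x + T n *\<^sub>R v + T n *\<^sub>R u) - f (x + T n *\<^sub>R v) - f (x + T n *\<^sub>R u) + f x = (T n)\<^sup>2 * H q u v"
    using second_difference_MVT[OF e T(1) _ d1 d2, of _ v u] T(2) by (metis add.commute)
  then obtain q where q: "\<And>n. norm (q n - x) \<le> T n * (norm v + norm u)"
    "\<And>n. f (x + T n *\<^sub>R v + T n *\<^sub>R u) - f (x + T n *\<^sub>R v) - f (x + T n *\<^sub>R u) + f x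
       = (T n)\<^sup>2 * H (q n) u v" by metis
  have "H (p n) v u = H (q n) u v" for n
  proof -
    have "(T n)\<^sup>2 * H (p n) v u = (T n)\<^sup>2 * H (q n) u v"
      unfolding p(2)[symmetric] q(2)[symmetric] by (simp add: algebra_simps)
    then show ?thesis using T(1)[of n] by simp
  qed
  with lims[OF p(1), of v u] lims[of q u v] q(1) show ?thesis
    by (simp add: add.commute LIMSEQ_unique)
qed

section \<open>Self-concordant functions\<close>

locale self_concordant =
  fixes D :: "'v::real_normed_vector set" and f :: "'v \<Rightarrow> real"
  assumes self_concordant: "self_concordant_on D f"
begin

lemma open_domain: "open D"
  and convex_on_domain: "convex_on D f"
  and closed_epigraph: "closed {(x, r). x \<in> D \<and> f x \<le> r}"
  using self_concordant by (auto simp: self_concordant_on_def)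

lemma deriv_f: "x \<in> D \<Longrightarrow> (f has_derivative blinfun_apply (fderiv f x)) (at x)"
  and deriv_gradient: "x \<in> D \<Longrightarrow> (fderiv f has_derivative blinfun_apply (hessian f x)) (at x)"
  and deriv_hessian:
    "x \<in> D \<Longrightarrow> (hessian f has_derivative blinfun_apply (fderiv (hessian f) x)) (at x)"
  using self_concordant by (auto simp: self_concordant_on_def intro: has_derivative_fderiv)

lemma continuous_f: "continuous_on D f"
  by (meson continuous_at_imp_continuous_on deriv_f has_derivative_continuous)

lemma hessian_symmetric:
  assumes "x \<in> D"
  shows "hessian f x u v = hessian f x v u"
proof -
  obtain e where "e > 0" "ball x e \<subseteq> D"
    using assms open_domain openE by blast
  then show ?thesis
    using assms deriv_hessian[THEN has_derivative_continuous]
    by (intro second_derivative_symmetric[of e x f "fderiv f"] deriv_f deriv_gradient) auto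
qed

text \<open>
  A convex function lies above its tangent planes: otherwise the derivative at \<open>x\<close> would make \<open>f\<close>
  exceed the chord from \<open>x\<close> to \<open>y\<close> for small steps.
\<close>

lemma gradient_inequality:
  assumes x: "x \<in> D" and y: "y \<in> D"
  shows "f x + fderiv f x (y - x) \<le> f y"
proof (rule ccontr)
  assume "\<not> ?thesis"
  then have pos: "fderiv f x (y - x) - (f y - f x) > 0" by simp
  let ?h = "\<lambda>\<tau>. f (x + \<tau> *\<^sub>R (y - x)) - \<tau> * (f y - f x)"
  have "((\<lambda>\<tau>. f (x + \<tau> *\<^sub>R (y - x))) has_real_derivative fderiv f x (y - x)) (at 0)"
    by (rule DERIV_along_line) (simp add: deriv_f x)
  then have "(?h has_real_derivative fderiv f x (y - x) - (f y - f x)) (at 0)"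
    by (auto intro!: derivative_eq_intros)
  from DERIV_pos_inc_right[OF this pos] obtain d where d: "d > 0"
    "\<And>\<tau>. 0 < \<tau> \<Longrightarrow> \<tau> < d \<Longrightarrow> ?h 0 < ?h \<tau>" by auto
  define \<tau> where "\<tau> = min (d / 2) 1"
  have \<tau>: "0 < \<tau>" "\<tau> < d" "\<tau> \<le> 1" using d(1) by (auto simp: \<tau>_def)
  have "f ((1 - \<tau>) *\<^sub>R x + \<tau> *\<^sub>R y) \<le> (1 - \<tau>) * f x + \<tau> * f y"
    using \<tau> x y by (intro convex_onD[OF convex_on_domain]) auto
  moreover have "(1 - \<tau>) *\<^sub>R x + \<tau> *\<^sub>R y = x + \<tau> *\<^sub>R (y - x)"
    by (simp add: algebra_simps)
  ultimately have "?h \<tau> \<le> ?h 0" by (simp add: algebra_simps)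
  with d(2)[OF \<tau>(1,2)] show False by simp
qed

lemma gradient_monotone:
  assumes "x \<in> D" "y \<in> D"
  shows "fderiv f x (y - x) \<le> fderiv f y (y - x)"
  using gradient_inequality[OF assms] gradient_inequality[OF assms(2,1)]
  by (simp add: blinfun.bilinear_simps)

lemma DERIV_gradient_along_line:
  assumes "x + t *\<^sub>R u \<in> D"
  shows "((\<lambda>\<tau>. fderiv f (x + \<tau> *\<^sub>R u) v) has_real_derivative hessian f (x + t *\<^sub>R u) u v) (at t)"
  by (rule DERIV_along_line[OF has_derivative_apply[OF deriv_gradient[OF assms]]])

lemma hessian_nonneg:
  assumes x: "x \<in> D"
  shows "0 \<le> hessian f x u u"
proof (rule ccontr)
  assume "\<not> ?thesis"
  then have neg: "hessian f x u u < 0" by simp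
  have "((\<lambda>\<tau>. fderiv f (x + \<tau> *\<^sub>R u) u) has_real_derivative hessian f x u u) (at 0)"
    using DERIV_gradient_along_line[of x 0 u u] x by simp
  from DERIV_neg_dec_right[OF this neg] obtain d where d: "d > 0"
    "\<And>\<tau>. 0 < \<tau> \<Longrightarrow> \<tau> < d \<Longrightarrow> fderiv f (x + \<tau> *\<^sub>R u) u < fderiv f x u" by auto
  obtain e where e: "e > 0" "ball x e \<subseteq> D"
    using x open_domain openE by blast
  define \<tau> where "\<tau> = min (d / 2) (e / (norm u + 1))"
  have nu: "norm u + 1 > 0" by (simp add: add_nonneg_pos)
  have \<tau>: "0 < \<tau>" "\<tau> < d" using d(1) e nu by (auto simp: \<tau>_def)
  have "\<tau> * norm u < \<tau> * (norm u + 1)" using \<tau> by simp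
  also have "\<dots> \<le> e / (norm u + 1) * (norm u + 1)"
    using nu by (intro mult_right_mono) (auto simp: \<tau>_def)
  also have "\<dots> = e" using nu by simp
  finally have "x + \<tau> *\<^sub>R u \<in> D"
    using e(2) \<tau> by (auto simp: dist_norm subset_iff)
  from gradient_monotone[OF x this] \<tau>
  have "fderiv f x u \<le> fderiv f (x + \<tau> *\<^sub>R u) u" by (simp add: blinfun.bilinear_simps)
  with d(2)[OF \<tau>] show False by simp
qed

lemma hessian_Cauchy_Schwarz:
  assumes x: "x \<in> D"
  shows "(hessian f x u v)\<^sup>2 \<le> hessian f x u u * hessian f x v v"
proof -
  define a b c where "a = hessian f x u u" and "b = hessian f x u v" and "c = hessian f x v v"
  have ac: "a \<ge> 0" "c \<ge> 0" using hessian_nonneg[OF x] by (auto simp: a_def c_def)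
  have quad: "0 \<le> a + 2 * r * b + r\<^sup>2 * c" for r
  proof -
    have "hessian f x (u + r *\<^sub>R v) (u + r *\<^sub>R v) = a + 2 * r * b + r\<^sup>2 * c"
      unfolding a_def b_def c_def
      by (simp add: blinfun.bilinear_simps hessian_symmetric[OF x, of v u] power2_eq_square algebra_simps)
    then show ?thesis using hessian_nonneg[OF x, of "u + r *\<^sub>R v"] by simp
  qed
  have "b\<^sup>2 \<le> a * c"
  proof (cases "c = 0")
    case True
    have "b = 0"
    proof (rule ccontr)
      assume "b \<noteq> 0"
      then show False using quad[of "- (a + 1) / (2 * b)"] True by (simp add: field_simps)
    qed
    then show ?thesis using ac by simp
  next
    case False
    with ac have c: "c > 0" by simp
    have "0 \<le> c * (a + 2 * (- b / c) * b + (- b / c)\<^sup>2 * c)"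
      by (rule mult_nonneg_nonneg[OF ac(2) quad])
    also have "\<dots> = a * c - b\<^sup>2" using c by (simp add: field_simps power2_eq_square)
    finally show ?thesis by simp
  qed
  then show ?thesis by (simp add: a_def b_def c_def)
qed

text \<open>
  The defining inequality bounds the third derivative from above only; replacing \<open>u\<close> by \<open>- u\<close>
  changes its sign and gives the bound from below.
\<close>

lemma third_derivative_bound:
  assumes x: "x \<in> D"
  shows "\<bar>fderiv (hessian f) x u u u\<bar> \<le> 2 * (hessian f x u u * sqrt (hessian f x u u))"
proof -
  have bound: "fderiv (hessian f) x h h h \<le> 2 * (hessian f x h h) powr (3 / 2)" for h
    using self_concordant x by (auto simp: self_concordant_on_def)
  have "z powr (3 / 2) = z * sqrt z" if "z \<ge> 0" for z :: real
    using that powr_add[of z 1 "1/2"] by (simp add: powr_half_sqrt)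
  then show ?thesis
    using bound[of u] bound[of "- u"] hessian_nonneg[OF x, of u]
    by (simp add: blinfun.bilinear_simps)
qed

text \<open>
  This is how self-concordance is used throughout. For \<open>\<phi> \<tau> = D\<^sup>2f(x + \<tau>u)[u]\<^sup>2\<close> it says
  \<open>\<bar>\<phi>'\<bar> \<le> 2 \<phi> powr (3/2)\<close>, that is, \<open>\<bar>(\<phi> powr (-1/2))'\<bar> \<le> 1\<close>. The shift by \<open>\<epsilon>\<close> preserves the
  inequality and avoids a case distinction on the vanishing of \<open>\<phi>\<close>, so that the lemma can be used
  before the Hessian is known to be definite.
\<close>

lemma inverse_local_norm_Lipschitz:
  assumes T: "0 \<le> T" and seg: "\<And>\<tau>. 0 \<le> \<tau> \<Longrightarrow> \<tau> \<le> T \<Longrightarrow> x + \<tau> *\<^sub>R u \<in> D"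
    and eps: "\<epsilon> > 0"
  shows "\<bar>1 / sqrt (hessian f (x + T *\<^sub>R u) u u + \<epsilon>) - 1 / sqrt (hessian f x u u + \<epsilon>)\<bar> \<le> T"
proof -
  define g where "g \<tau> = hessian f (x + \<tau> *\<^sub>R u) u u + \<epsilon>" for \<tau>
  define g' where "g' \<tau> = fderiv (hessian f) (x + \<tau> *\<^sub>R u) u u u" for \<tau>
  define q' where "q' \<tau> = - (g' \<tau> / (2 * (g \<tau> * sqrt (g \<tau>))))" for \<tau>
  have gpos: "g \<tau> > 0" if "0 \<le> \<tau>" "\<tau> \<le> T" for \<tau>
    using hessian_nonneg[OF seg[OF that]] eps by (simp add: g_def add_nonneg_pos)
  have Dg: "(g has_real_derivative g' \<tau>) (at \<tau>)" if "0 \<le> \<tau>" "\<tau> \<le> T" for \<tau>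
    unfolding g_def g'_def
    using DERIV_along_line[OF has_derivative_apply[OF has_derivative_apply[OF deriv_hessian[OF seg[OF that]]]], of u u]
    by (auto intro!: derivative_eq_intros)
  have Dq: "((\<lambda>\<tau>. 1 / sqrt (g \<tau>)) has_real_derivative q' \<tau>) (at \<tau>)" if "0 \<le> \<tau>" "\<tau> \<le> T" for \<tau>
    using gpos[OF that]
    by (auto intro!: derivative_eq_intros Dg[OF that] simp: q'_def field_simps)
  have q': "\<bar>q' \<tau>\<bar> \<le> 1" if "0 \<le> \<tau>" "\<tau> \<le> T" for \<tau>
  proof -
    have "\<bar>g' \<tau>\<bar> \<le> 2 * (hessian f (x + \<tau> *\<^sub>R u) u u * sqrt (hessian f (x + \<tau> *\<^sub>R u) u u))"
      unfolding g'_def by (rule third_derivative_bound[OF seg[OF that]])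
    also have "\<dots> \<le> 2 * (g \<tau> * sqrt (g \<tau>))"
      using hessian_nonneg[OF seg[OF that]] eps unfolding g_def by (intro mult_left_mono mult_mono) auto
    finally show ?thesis using gpos[OF that] by (simp add: q'_def abs_mult)
  qed
  show ?thesis
  proof (cases "T = 0")
    case False
    then have "0 < T" using T by simp
    from MVT2[OF this Dq] obtain z where "0 < z" "z < T"
      "1 / sqrt (g T) - 1 / sqrt (g 0) = (T - 0) * q' z" by auto
    then have "\<bar>1 / sqrt (g T) - 1 / sqrt (g 0)\<bar> = T * \<bar>q' z\<bar>" "\<bar>q' z\<bar> \<le> 1"
      using q' T by (auto simp: abs_mult)
    then show ?thesis using T by (simp add: g_def mult_left_le)
  qed simp
qed

text \<open>
  Along the ray the reciprocal of the local norm decreases at most at unit speed. It starts above 1,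
  hence stays bounded away from 0 during unit time, so the second derivative, the gradient and \<open>f\<close>
  itself stay bounded. As the epigraph is closed, the ray cannot leave the domain in that time.
\<close>

theorem Dikin_ellipsoid:
  assumes x: "x \<in> D" and u: "hessian f x u u < 1"
  shows "x + u \<in> D"
proof (rule ccontr)
  assume out: "x + u \<notin> D"
  define \<epsilon> where "\<epsilon> = (1 - hessian f x u u) / 2"
  have eps: "\<epsilon> > 0" "hessian f x u u + \<epsilon> < 1" using u by (auto simp: \<epsilon>_def field_simps)
  have H0: "hessian f x u u \<ge> 0" by (rule hessian_nonneg[OF x])
  define \<delta> where "\<delta> = 1 / sqrt (hessian f x u u + \<epsilon>) - 1"
  have \<delta>: "\<delta> > 0" using H0 eps by (simp add: \<delta>_def)
  have Hbound: "hessian f (x + \<tau> *\<^sub>R u) u u \<le> 1 / \<delta>\<^sup>2"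
    if \<tau>: "0 \<le> \<tau>" "\<tau> \<le> 1" and seg: "\<And>\<sigma>. 0 \<le> \<sigma> \<Longrightarrow> \<sigma> \<le> \<tau> \<Longrightarrow> x + \<sigma> *\<^sub>R u \<in> D" for \<tau>
  proof -
    let ?g = "hessian f (x + \<tau> *\<^sub>R u) u u + \<epsilon>"
    have g: "?g > 0" using hessian_nonneg[OF seg[of \<tau>]] \<tau> eps by (simp add: add_nonneg_pos)
    have "\<delta> \<le> 1 / sqrt ?g"
      using inverse_local_norm_Lipschitz[OF \<tau>(1) seg eps(1)] \<tau> by (simp add: \<delta>_def abs_le_iff)
    then have "\<delta> * sqrt ?g \<le> 1" using g by (simp add: field_simps)
    then have "(\<delta> * sqrt ?g)\<^sup>2 \<le> 1" using \<delta> g by (intro power_le_one) auto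
    then have "?g \<le> 1 / \<delta>\<^sup>2" using \<delta> g by (simp add: power_mult_distrib field_simps)
    then show ?thesis using eps by simp
  qed
  define S where "S = {0..1} \<inter> (\<lambda>\<tau>. x + \<tau> *\<^sub>R u) -` (- D)"
  have "closed S"
    unfolding S_def
    by (intro closed_Int closed_atLeastAtMost closed_vimage continuous_intros) 
      (use open_domain in \<open>simp add: closed_Compl\<close>)
  moreover have "1 \<in> S" using out by (simp add: S_def)
  moreover have "bdd_below S" by (rule bdd_belowI[of _ 0]) (simp add: S_def)
  ultimately have TS: "Inf S \<in> S" using closed_contains_Inf by blast
  \<comment> \<open>The first moment at which the ray is outside of the domain.\<close>
  define T where "T = Inf S"
  have T: "0 \<le> T" "T \<le> 1" "x + T *\<^sub>R u \<notin> D" using TS by (auto simp: S_def T_def)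
  with x have T0: "T > 0" by (cases "T = 0") auto
  have before: "x + \<tau> *\<^sub>R u \<in> D" if "0 \<le> \<tau>" "\<tau> < T" for \<tau>
  proof (rule ccontr)
    assume "x + \<tau> *\<^sub>R u \<notin> D"
    then have "\<tau> \<in> S" using that T by (simp add: S_def)
    then have "T \<le> \<tau>" unfolding T_def by (rule cInf_lower) fact
    then show False using that by simp
  qed
  define N where "N = \<bar>fderiv f x u\<bar> + 1 / \<delta>\<^sup>2"
  have N: "N \<ge> 0" by (simp add: N_def)
  have f_bound: "f (x + \<tau> *\<^sub>R u) \<le> f x + N" if \<tau>: "0 \<le> \<tau>" "\<tau> < T" for \<tau>
  proof (cases "\<tau> = 0")
    case False
    then have pos: "\<tau> > 0" using \<tau> by simp
    have "\<exists>z>0. z < \<tau> \<and> fderiv f (x + \<tau> *\<^sub>R u) u - fderiv f (x + 0 *\<^sub>R u) u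
        = (\<tau> - 0) * hessian f (x + z *\<^sub>R u) u u"
      by (rule MVT2[OF pos, of "\<lambda>\<tau>. fderiv f (x + \<tau> *\<^sub>R u) u"])
        (rule DERIV_gradient_along_line, use before \<tau> in auto)
    then obtain z where z: "0 < z" "z < \<tau>"
      "fderiv f (x + \<tau> *\<^sub>R u) u = fderiv f x u + \<tau> * hessian f (x + z *\<^sub>R u) u u"
      by auto
    have Hz: "hessian f (x + z *\<^sub>R u) u u \<le> 1 / \<delta>\<^sup>2"
      using z \<tau> T before by (intro Hbound) auto
    have "hessian f (x + z *\<^sub>R u) u u \<ge> 0"
      using z \<tau> before by (intro hessian_nonneg) auto
    then have "\<tau> * hessian f (x + z *\<^sub>R u) u u \<le> 1 / \<delta>\<^sup>2"
      using Hz \<tau> T by (meson less_le_trans mult_left_le_one_le less_imp_le order_trans)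
    then have le: "fderiv f (x + \<tau> *\<^sub>R u) u \<le> N"
      using z(3) by (simp add: N_def)
    \<comment> \<open>The tangent plane at the end point bounds \<open>f\<close> there from above in terms of \<open>f x\<close>.\<close>
    have "f (x + \<tau> *\<^sub>R u) \<le> f x + \<tau> * fderiv f (x + \<tau> *\<^sub>R u) u"
      using gradient_inequality[OF before[OF \<tau>] x] by (simp add: blinfun.bilinear_simps)
    also have "\<tau> * fderiv f (x + \<tau> *\<^sub>R u) u \<le> \<tau> * N"
      using le \<tau> by (intro mult_left_mono)
    also have "\<tau> * N \<le> N" using \<tau> T N by (intro mult_left_le_one_le) auto
    finally show ?thesis by simp
  qed (use N in simp)
  let ?C = "(\<lambda>\<tau>. (x + \<tau> *\<^sub>R u, f x + N)) -` {(x, r). x \<in> D \<and> f x \<le> r}"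
  \<comment> \<open>The first exit point is a limit of points of the epigraph at the fixed height \<open>f x + N\<close>.\<close>
  have "closed ?C"
    by (rule closed_vimage[OF closed_epigraph]) (intro continuous_intros)
  moreover have "{0..<T} \<subseteq> ?C" using before f_bound by auto
  ultimately have "closure {0..<T} \<subseteq> ?C" by (rule closure_minimal[rotated])
  moreover have "T \<in> closure {0..<T}" using T0 by simp
  ultimately have "T \<in> ?C" by blast
  then show False using T(3) by simp
qed

end

section \<open>Interiors of the cone and of its dual\<close>

lemma interior_dual_cone_bound:
  fixes K :: "'a::euclidean_space set"
  assumes "s \<in> interior (dual_cone K)"
  obtains \<alpha> where "\<alpha> > 0" "\<And>x. x \<in> K \<Longrightarrow> \<alpha> * norm x \<le> blinfun_apply s x"
proof -
  obtain e where e: "e > 0" "ball s e \<subseteq> dual_cone K"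
    using assms mem_interior by blast
  have "e / 2 * norm x \<le> s x" if x: "x \<in> K" for x
  proof (cases "x = 0")
    case False
    \<comment> \<open>A perturbation of norm \<open>e / 2\<close> that lowers the value at \<open>x\<close> as much as possible.\<close>
    define g where "g = blinfun_inner_right ((e / (2 * norm x)) *\<^sub>R x)"
    have "norm g \<le> e / 2"
    proof (rule norm_blinfun_bound)
      fix y
      have "norm (g y) \<le> norm ((e / (2 * norm x)) *\<^sub>R x) * norm y"
        unfolding g_def blinfun_inner_right.rep_eq by (rule Cauchy_Schwarz_ineq2[folded real_norm_def])
      then show "norm (g y) \<le> e / 2 * norm y" using e(1) False by simp
    qed (use e in simp)
    then have "s - g \<in> ball s e" using e(1) by (simp add: dist_norm)
    then have "s - g \<in> dual_cone K" using e(2) by blast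
    then have "0 \<le> (s - g) x" using x by (auto simp: dual_cone_def)
    moreover have "g x = e / 2 * norm x"
      using False by (simp add: g_def power2_norm_eq_inner[symmetric] power2_eq_square)
    ultimately show ?thesis by (simp add: blinfun.bilinear_simps)
  qed simp
  with e show thesis by (intro that[of "e / 2"]) auto
qed

text \<open>
  By homogeneity only the compact set of unit vectors of \<open>K\<close> matters, where \<open>s\<close> is bounded away from
  zero.
\<close>

lemma interior_dual_coneI:
  fixes K :: "'a::euclidean_space set"
  assumes K: "closed K" "cone K"
    and pos: "\<And>x. x \<in> K \<Longrightarrow> x \<noteq> 0 \<Longrightarrow> 0 < blinfun_apply s x"
  shows "s \<in> interior (dual_cone K)"
proof -
  have comp: "compact (sphere 0 1 \<inter> K)"
    using K by (intro compact_Int_closed) auto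
  obtain m where m: "m > 0" "\<And>x. x \<in> sphere 0 1 \<inter> K \<Longrightarrow> m \<le> s x"
  proof (cases "sphere 0 1 \<inter> K = {}")
    case True
    then show thesis by (intro that[of 1]) auto
  next
    case False
    then obtain z where "z \<in> sphere 0 1 \<inter> K" "\<And>x. x \<in> sphere 0 1 \<inter> K \<Longrightarrow> s z \<le> s x"
      using continuous_attains_inf[OF comp False, of "blinfun_apply s"]
        linear_continuous_on[OF blinfun.bounded_linear_right] by blast
    then show thesis by (intro that[of "s z"] pos) auto
  qed
  have lower: "m * norm x \<le> s x" if x: "x \<in> K" for x
  proof (cases "x = 0")
    case False
    then have "(1 / norm x) *\<^sub>R x \<in> sphere 0 1 \<inter> K"
      using x K by (auto intro: mem_cone)
    from m(2)[OF this] False show ?thesis by (simp add: blinfun.bilinear_simps field_simps)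
  qed simp
  have "ball s m \<subseteq> dual_cone K"
  proof
    fix s' assume "s' \<in> ball s m"
    then have n: "norm (s - s') \<le> m" by (simp add: dist_norm)
    have "0 \<le> s' x" if x: "x \<in> K" for x
    proof -
      have "\<bar>(s - s') x\<bar> \<le> norm (s - s') * norm x"
        using norm_blinfun[of "s - s'" x] by simp
      also have "\<dots> \<le> m * norm x" using n by (intro mult_right_mono) auto
      finally show ?thesis using lower[OF x] by (simp add: blinfun.bilinear_simps)
    qed
    then show "s' \<in> dual_cone K" by (simp add: dual_cone_def)
  qed
  with m(1) show ?thesis using mem_interior by blast
qed

lemma scaleR_interior_cone:
  fixes K :: "'a::real_normed_vector set"
  assumes "cone K" "x \<in> interior K" "\<tau> > 0"
  shows "\<tau> *\<^sub>R x \<in> interior K"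
proof -
  have "(*\<^sub>R) \<tau> ` interior K \<subseteq> K"
    using assms interior_subset[of K] by (auto intro: mem_cone)
  moreover have "open ((*\<^sub>R) \<tau> ` interior K)" using assms(3) by auto
  ultimately have "(*\<^sub>R) \<tau> ` interior K \<subseteq> interior K" by (rule interior_maximal)
  with assms(2) show ?thesis by blast
qed

lemma add_interior_cone:
  fixes K :: "'a::real_normed_vector set"
  assumes "convex K" "cone K" "x \<in> interior K" "u \<in> K"
  shows "x + u \<in> interior K"
proof -
  have "(\<lambda>y. u + y) ` interior K \<subseteq> K"
    using assms interior_subset[of K] convex_cone[of K] by auto
  moreover have "open ((\<lambda>y. u + y) ` interior K)" by (intro open_translation open_interior)
  ultimately have "(\<lambda>y. u + y) ` interior K \<subseteq> interior K" by (rule interior_maximal)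
  with assms(3) show ?thesis by (auto simp: add.commute)
qed

lemma cone_dual_cone: "cone (dual_cone K)"
  by (auto simp: cone_def dual_cone_def blinfun.bilinear_simps)

section \<open>Logarithmically homogeneous barriers\<close>

locale normal_cone_barrier =
  fixes K :: "'a::euclidean_space set" and \<nu> :: real and F :: "'a \<Rightarrow> real"
  assumes closed_K: "closed K" and convex_K: "convex K" and cone_K: "cone K"
    and pointed_K: "pointed K" and interior_K: "interior K \<noteq> {}"
    and normal_barrier: "normal_barrier K \<nu> F"
begin

sublocale self_concordant "interior K" F
  using normal_barrier by unfold_locales (simp add: normal_barrier_def)

lemma log_homogeneous: "x \<in> interior K \<Longrightarrow> \<tau> > 0 \<Longrightarrow> F (\<tau> *\<^sub>R x) = F x - \<nu> * ln \<tau>"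
  and parameter_ge_1: "\<nu> \<ge> 1"
  using normal_barrier by (auto simp: normal_barrier_def)

lemmas scaleR_interior = scaleR_interior_cone[OF cone_K]
  and add_interior = add_interior_cone[OF convex_K cone_K]

lemma gradient_scaleR:
  assumes x: "x \<in> interior K" and \<tau>: "\<tau> > 0"
  shows "fderiv F (\<tau> *\<^sub>R x) = (1 / \<tau>) *\<^sub>R fderiv F x"
proof -
  have "((\<lambda>y. F y - \<nu> * ln \<tau>) has_derivative fderiv F x) (at x)"
    using deriv_f[OF x] by (auto intro!: derivative_eq_intros)
  then have "((\<lambda>y. F (\<tau> *\<^sub>R y)) has_derivative fderiv F x) (at x)"
    by (rule has_derivative_transform_within_open[OF _ open_domain x]) 
      (simp add: log_homogeneous \<tau>)
  moreover have "((\<lambda>y. F (\<tau> *\<^sub>R y)) has_derivative (\<lambda>h. fderiv F (\<tau> *\<^sub>R x) (\<tau> *\<^sub>R h))) (at x)"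
    by (intro has_derivative_scaled deriv_f scaleR_interior x \<tau>)
  ultimately have "fderiv F x h = fderiv F (\<tau> *\<^sub>R x) (\<tau> *\<^sub>R h)" for h
    using has_derivative_unique by metis
  then show ?thesis using \<tau> by (intro blinfun_eqI) (simp add: blinfun.bilinear_simps)
qed

lemma hessian_scaleR:
  assumes x: "x \<in> interior K" and \<tau>: "\<tau> > 0"
  shows "hessian F (\<tau> *\<^sub>R x) = (1 / \<tau>\<^sup>2) *\<^sub>R hessian F x"
proof -
  have "((\<lambda>y. (1 / \<tau>) *\<^sub>R fderiv F y) has_derivative (\<lambda>h. (1 / \<tau>) *\<^sub>R hessian F x h)) (at x)"
    using deriv_gradient[OF x] by (auto intro!: derivative_eq_intros)
  then have "((\<lambda>y. fderiv F (\<tau> *\<^sub>R y)) has_derivative (\<lambda>h. (1 / \<tau>) *\<^sub>R hessian F x h)) (at x)"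
    by (rule has_derivative_transform_within_open[OF _ open_domain x])
      (simp add: gradient_scaleR \<tau>)
  moreover have "((\<lambda>y. fderiv F (\<tau> *\<^sub>R y)) has_derivative (\<lambda>h. hessian F (\<tau> *\<^sub>R x) (\<tau> *\<^sub>R h))) (at x)"
    by (intro has_derivative_scaled deriv_gradient scaleR_interior x \<tau>)
  ultimately have "(1 / \<tau>) *\<^sub>R hessian F x h = hessian F (\<tau> *\<^sub>R x) (\<tau> *\<^sub>R h)" for h
    using has_derivative_unique by metis
  then have "(1 / \<tau>) *\<^sub>R (1 / \<tau>) *\<^sub>R hessian F x h = (1 / \<tau>) *\<^sub>R \<tau> *\<^sub>R hessian F (\<tau> *\<^sub>R x) h" for h
    by (simp add: blinfun.bilinear_simps)
  then show ?thesis using \<tau>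
    by (intro blinfun_eqI[of "hessian F (\<tau> *\<^sub>R x)"]) (simp add: blinfun.bilinear_simps power2_eq_square)
qed

text \<open>
  Euler's relation: differentiate \<open>DF(\<tau>x) = DF(x) / \<tau>\<close> at \<open>\<tau> = 1\<close>.
\<close>

lemma hessian_apply_self:
  assumes x: "x \<in> interior K"
  shows "hessian F x x = - fderiv F x"
proof (rule blinfun_eqI)
  fix v
  have 1: "((\<lambda>\<tau>. fderiv F (x + \<tau> *\<^sub>R x) v) has_real_derivative hessian F x x v) (at 0)"
    using DERIV_gradient_along_line[of x 0 x v] x by simp
  have "((\<lambda>\<tau>. (1 / (1 + \<tau>)) * fderiv F x v) has_real_derivative - fderiv F x v) (at 0)"
    by (auto intro!: derivative_eq_intros)
  then have "((\<lambda>\<tau>. fderiv F (x + \<tau> *\<^sub>R x) v) has_real_derivative - fderiv F x v) (at 0)"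
  proof (rule has_field_derivative_transform_within_open[of _ _ _ "{-1<..}"])
    fix \<tau> :: real assume "\<tau> \<in> {-1<..}"
    then have "fderiv F ((1 + \<tau>) *\<^sub>R x) = (1 / (1 + \<tau>)) *\<^sub>R fderiv F x"
      by (intro gradient_scaleR x) simp
    then show "1 / (1 + \<tau>) * fderiv F x v = fderiv F (x + \<tau> *\<^sub>R x) v"
      by (simp add: scaleR_left_distrib blinfun.bilinear_simps)
  qed auto
  with 1 show "hessian F x x v = (- fderiv F x) v"
    using DERIV_unique by (fastforce simp: blinfun.bilinear_simps)
qed

lemma ray_in_cone:
  assumes "\<And>n::nat. x + real n *\<^sub>R u \<in> K"
  shows "u \<in> K"
proof -
  have "(\<lambda>n. inverse (real (Suc n)) *\<^sub>R x + u) \<longlonglongrightarrow> 0 *\<^sub>R x + u"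
    by (intro tendsto_intros LIMSEQ_inverse_real_of_nat)
  moreover have "inverse (real (Suc n)) *\<^sub>R x + u \<in> K" for n
  proof -
    have "inverse (real (Suc n)) *\<^sub>R (x + real (Suc n) *\<^sub>R u) \<in> K"
      by (rule mem_cone[OF cone_K assms]) simp
    moreover have "inverse (real (Suc n)) *\<^sub>R (x + real (Suc n) *\<^sub>R u) = inverse (real (Suc n)) *\<^sub>R x + u"
      by (simp only: scaleR_right_distrib scaleR_scaleR) simp
    ultimately show ?thesis by simp
  qed
  ultimately show ?thesis
    using closed_sequentially[OF closed_K, of "\<lambda>n. inverse (real (Suc n)) *\<^sub>R x + u" u] by simp
qed

text \<open>
  If \<open>\<parallel>u\<parallel>\<^sub>x = 0\<close>, then the Dikin ellipsoid at \<open>x\<close> contains the whole line in direction \<open>u\<close>, and a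
  pointed cone contains no line.
\<close>

lemma hessian_definite:
  assumes x: "x \<in> interior K" and u: "hessian F x u u = 0"
  shows "u = 0"
proof -
  have "x + \<tau> *\<^sub>R u \<in> K" for \<tau>
    using Dikin_ellipsoid[OF x, of "\<tau> *\<^sub>R u"] u interior_subset[of K]
    by (auto simp: blinfun.bilinear_simps)
  from this[of "real _"] this[of "- real _"] have "u \<in> K" "- u \<in> K"
    by (auto intro!: ray_in_cone[of x u] ray_in_cone[of x "- u"])
  then show ?thesis using pointed_K by (auto simp: pointed_def)
qed

lemma hessian_pos:
  assumes "x \<in> interior K" "u \<noteq> 0"
  shows "0 < hessian F x u u"
  using hessian_nonneg[OF assms(1), of u] hessian_definite[OF assms(1), of u] assms(2) by linarith

lemma bij_hessian: "x \<in> interior K \<Longrightarrow> bij (blinfun_apply (hessian F x))"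
  by (rule positive_form_bij) (rule hessian_definite)

text \<open>
  Along a segment, the derivative of the gradient in the direction of the segment is positive.
\<close>

lemma inj_on_gradient: "inj_on (fderiv F) (interior K)"
proof (rule inj_onI, rule ccontr)
  fix x y assume x: "x \<in> interior K" and y: "y \<in> interior K"
    and eq: "fderiv F x = fderiv F y" and ne: "x \<noteq> y"
  have seg: "x + \<tau> *\<^sub>R (y - x) \<in> interior K" if "0 \<le> \<tau>" "\<tau> \<le> 1" for \<tau>
  proof -
    have "(1 - \<tau>) *\<^sub>R x + \<tau> *\<^sub>R y \<in> interior K"
      using that x y convex_interior[OF convex_K] by (intro convexD) auto
    then show ?thesis by (simp add: algebra_simps)
  qed
  have "\<exists>z>0. z < 1 \<and> fderiv F (x + 1 *\<^sub>R (y - x)) (y - x) - fderiv F (x + 0 *\<^sub>R (y - x)) (y - x)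
        = (1 - 0) * hessian F (x + z *\<^sub>R (y - x)) (y - x) (y - x)"
    by (rule MVT2[of 0 1 "\<lambda>\<tau>. fderiv F (x + \<tau> *\<^sub>R (y - x)) (y - x)"])
      (auto intro!: DERIV_gradient_along_line seg)
  then obtain z where "0 < z" "z < 1" "hessian F (x + z *\<^sub>R (y - x)) (y - x) (y - x) = 0"
    using eq by auto
  then have "y - x = 0" using seg by (intro hessian_definite[of "x + z *\<^sub>R (y - x)"]) auto
  with ne show False by simp
qed

text \<open>
  By logarithmic homogeneity \<open>F(x + \<tau>w)\<close> stays below \<open>max (F x) (F w)\<close> for \<open>w\<close> in the interior of
  \<open>K\<close>, because \<open>x + \<tau>w\<close> is \<open>1 + \<tau>\<close> times a convex combination of \<open>x\<close> and \<open>w\<close>. A convex function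
  that is bounded above on a ray does not increase along it. Boundary directions follow by
  continuity.
\<close>

lemma gradient_nonpos:
  assumes x: "x \<in> interior K" and u: "u \<in> K"
  shows "fderiv F x u \<le> 0"
proof -
  have int: "fderiv F x w \<le> 0" if w: "w \<in> interior K" for w
  proof (rule ccontr)
    assume "\<not> ?thesis"
    then have pos: "fderiv F x w > 0" by simp
    define M where "M = max (F x) (F w)"
    have bound: "\<tau> * fderiv F x w \<le> M - F x" if \<tau>: "\<tau> > 0" for \<tau>
    proof -
      let ?z = "(1 - \<tau> / (1 + \<tau>)) *\<^sub>R x + (\<tau> / (1 + \<tau>)) *\<^sub>R w"
      have c: "1 - \<tau> / (1 + \<tau>) = 1 / (1 + \<tau>)" using \<tau> by (simp add: field_simps)
      have zI: "?z \<in> interior K"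
        using \<tau> x w convex_interior[OF convex_K] by (intro convexD) auto
      have sc: "(1 + \<tau>) *\<^sub>R ?z = x + \<tau> *\<^sub>R w" 
        using \<tau> unfolding c by (simp add: scaleR_right_distrib)
      have "F ?z \<le> (1 - \<tau> / (1 + \<tau>)) * F x + (\<tau> / (1 + \<tau>)) * F w"
        using \<tau> by (intro convex_onD[OF convex_on_domain] x w) auto
      also have "\<dots> \<le> (1 - \<tau> / (1 + \<tau>)) * M + (\<tau> / (1 + \<tau>)) * M"
        unfolding c using \<tau> by (intro add_mono mult_left_mono) (auto simp: M_def)
      also have "\<dots> = M" by (simp add: algebra_simps)
      finally have Fz: "F ?z \<le> M" .
      have "F (x + \<tau> *\<^sub>R w) = F ?z - \<nu> * ln (1 + \<tau>)"
        using log_homogeneous[OF zI, of "1 + \<tau>"] \<tau> sc by simp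
      also have "0 \<le> \<nu> * ln (1 + \<tau>)"
        using parameter_ge_1 \<tau> by (intro mult_nonneg_nonneg) auto
      then have "F ?z - \<nu> * ln (1 + \<tau>) \<le> M" using Fz by linarith
      finally have "F (x + \<tau> *\<^sub>R w) \<le> M" .
      moreover have "x + \<tau> *\<^sub>R w \<in> interior K"
        using scaleR_interior[OF zI, of "1 + \<tau>"] \<tau> sc by simp
      then have "F x + fderiv F x (\<tau> *\<^sub>R w) \<le> F (x + \<tau> *\<^sub>R w)"
        using gradient_inequality[OF x, of "x + \<tau> *\<^sub>R w"] by simp
      ultimately show ?thesis by (simp add: blinfun.bilinear_simps)
    qed
    have "M - F x \<ge> 0" by (simp add: M_def)
    then show False using bound[of "(M - F x + 1) / fderiv F x w"] pos by simp
  qed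
  have "((\<lambda>\<epsilon>. fderiv F x (u + \<epsilon> *\<^sub>R x)) \<longlongrightarrow> fderiv F x (u + 0 *\<^sub>R x)) (at_right 0)"
    by (intro tendsto_intros)
  moreover have "\<forall>\<^sub>F \<epsilon> in at_right 0. fderiv F x (u + \<epsilon> *\<^sub>R x) \<le> 0"
    using eventually_at_right_less[of "0::real"]
  proof eventually_elim
    case (elim \<epsilon>)
    show ?case using add_interior[OF scaleR_interior[OF x elim] u]
      by (intro int) (simp add: add.commute)
  qed
  ultimately show ?thesis
    using tendsto_upperbound[of _ _ "at_right (0::real)" 0] by fastforce
qed

text \<open>
  Along the ray \<open>x + \<sigma>u\<close> the second derivative is at least \<open>r\<^sup>2 / (1 + r\<sigma>)\<^sup>2\<close> with \<open>r = \<parallel>u\<parallel>\<^sub>x\<close>, whose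
  integral over the whole ray is \<open>r\<close>. So the slope grows by at least \<open>r\<close> in total, and yet it never
  becomes positive.
\<close>

lemma local_norm_le_neg_gradient:
  assumes x: "x \<in> interior K" and u: "u \<in> K"
  shows "sqrt (hessian F x u u) \<le> - fderiv F x u"
proof -
  define r where "r = sqrt (hessian F x u u)"
  have ray: "x + \<sigma> *\<^sub>R u \<in> interior K" if "0 \<le> \<sigma>" for \<sigma>
    by (intro add_interior x mem_cone[OF cone_K u] that)
  have bound: "r \<le> - fderiv F x u + 2 / \<tau>" if \<tau>: "\<tau> > 0" for \<tau>
  proof -
    \<comment> \<open>The shift contributes \<open>\<epsilon> * \<tau>\<close> over the length \<open>\<tau>\<close>, which must vanish as \<open>\<tau>\<close> grows.\<close>
    define \<epsilon> where "\<epsilon> = 1 / \<tau>\<^sup>2"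
    have eps: "\<epsilon> > 0" using \<tau> by (simp add: \<epsilon>_def)
    define q where "q = 1 / sqrt (hessian F x u u + \<epsilon>)"
    have H0: "hessian F x u u \<ge> 0" by (rule hessian_nonneg[OF x])
    have q: "q > 0" using H0 eps by (simp add: q_def)
    \<comment> \<open>Up to a constant, the slope minus the integral of the lower bound for its derivative.\<close>
    let ?\<Phi> = "\<lambda>\<sigma>. fderiv F (x + \<sigma> *\<^sub>R u) u + 1 / (q + \<sigma>) + \<epsilon> * \<sigma>"
    have "?\<Phi> 0 \<le> ?\<Phi> \<tau>"
    proof (rule DERIV_nonneg_imp_nondecreasing[of 0 \<tau> ?\<Phi>])
      fix \<sigma> assume \<sigma>: "0 \<le> \<sigma>" "\<sigma> \<le> \<tau>"
      let ?H = "hessian F (x + \<sigma> *\<^sub>R u) u u"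
      have H: "?H \<ge> 0" by (intro hessian_nonneg ray \<sigma>)
      have qs: "q + \<sigma> > 0" using q \<sigma> by simp
      have "(?\<Phi> has_real_derivative ?H - 1 / (q + \<sigma>)\<^sup>2 + \<epsilon>) (at \<sigma>)"
        using qs by (auto intro!: derivative_eq_intros DERIV_gradient_along_line ray \<sigma>
            simp: power2_eq_square)
      moreover have "1 / (q + \<sigma>)\<^sup>2 \<le> ?H + \<epsilon>"
      proof -
        have "1 / sqrt (?H + \<epsilon>) \<le> q + \<sigma>"
          using inverse_local_norm_Lipschitz[OF \<sigma>(1) ray eps] by (simp add: q_def abs_le_iff)
        then have "1 / (q + \<sigma>) \<le> sqrt (?H + \<epsilon>)"
          using H eps qs by (simp add: field_simps)
        then have "(1 / (q + \<sigma>))\<^sup>2 \<le> (sqrt (?H + \<epsilon>))\<^sup>2"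
          using qs by (intro power_mono) auto
        then show ?thesis using H eps by (simp add: power_divide)
      qed
      ultimately show "\<exists>y. (?\<Phi> has_real_derivative y) (at \<sigma>) \<and> 0 \<le> y"
        by (intro exI conjI) auto
    qed (use \<tau> in simp)
    moreover have "r \<le> 1 / q"
      unfolding q_def r_def using eps by simp
    moreover have "fderiv F (x + \<tau> *\<^sub>R u) u \<le> 0"
      using \<tau> by (intro gradient_nonpos ray u) auto
    moreover have "1 / (q + \<tau>) \<le> 1 / \<tau>" using q \<tau> by (simp add: field_simps)
    moreover have "\<epsilon> * \<tau> = 1 / \<tau>" using \<tau> by (simp add: \<epsilon>_def power2_eq_square)
    ultimately show ?thesis by simp
  qed
  show ?thesis
  proof (rule ccontr)
    assume "\<not> ?thesis"
    then have "r + fderiv F x u > 0" by (simp add: r_def)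
    then show False using bound[of "4 / (r + fderiv F x u)"] by (simp add: field_simps)
  qed
qed

text \<open>
  With \<open>s = - DF(x)\<close> and \<open>g = D\<^sup>2F(x) v\<close> the hypothesis reads \<open>\<parallel>g\<parallel>\<^sub>s < 1\<close>. For nonzero \<open>w\<close> in \<open>K\<close> the
  Cauchy-Schwarz inequality bounds \<open>\<bar>\<langle>g, w\<rangle>\<bar>\<close> by \<open>\<parallel>g\<parallel>\<^sub>s \<parallel>w\<parallel>\<^sub>x\<close>, which is less than \<open>\<langle>s, w\<rangle>\<close> by the previous
  lemma. This replaces the argument through self-concordance of the dual barrier.
\<close>

theorem dual_Dikin_ellipsoid:
  assumes x: "x \<in> interior K" and v: "hessian F x v v < 1"
  shows "- fderiv F x + hessian F x v \<in> interior (dual_cone K)"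
proof (rule interior_dual_coneI[OF closed_K cone_K])
  fix w assume w: "w \<in> K" "w \<noteq> 0"
  define a where "a = sqrt (hessian F x w w)"
  define r where "r = sqrt (hessian F x v v)"
  have a: "a > 0" using hessian_pos[OF x w(2)] by (simp add: a_def)
  have r: "r < 1" using v by (simp add: r_def)
  have "\<bar>hessian F x v w\<bar> \<le> r * a"
  proof -
    have "sqrt ((hessian F x v w)\<^sup>2) \<le> sqrt (hessian F x v v * hessian F x w w)"
      by (intro real_sqrt_le_mono hessian_Cauchy_Schwarz x)
    then show ?thesis by (simp add: real_sqrt_mult a_def r_def)
  qed
  also have "r * a < a" using a r by simp
  also have "a \<le> - fderiv F x w"
    unfolding a_def by (rule local_norm_le_neg_gradient[OF x w(1)])
  finally show "0 < (- fderiv F x + hessian F x v) w"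
    by (simp add: blinfun.bilinear_simps)
qed

end

section \<open>The dual barrier\<close>

context normal_cone_barrier
begin

text \<open>
  A minimiser of \<open>F + s\<close> on the open cone is a point with \<open>- DF(x) = s\<close>. It exists because the
  sublevel sets of \<open>F + s\<close> are compact. They are closed since the epigraph of \<open>F\<close> is. They are bounded
  since \<open>s\<close> grows linearly on \<open>K\<close>, while the tangent plane of \<open>F\<close> at a fixed point, applied to
  \<open>x / \<tau>\<close> instead of \<open>x\<close>, shows that \<open>F\<close> decreases at most linearly, with arbitrarily small slope.
\<close>

lemma gradient_attains_dual:
  assumes s: "s \<in> interior (dual_cone K)"
  shows "\<exists>x\<in>interior K. - fderiv F x = s"
proof -
  obtain \<alpha> where \<alpha>: "\<alpha> > 0" "\<And>x. x \<in> K \<Longrightarrow> \<alpha> * norm x \<le> s x"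
    using interior_dual_cone_bound[OF s] by blast
  obtain x1 where x1: "x1 \<in> interior K" using interior_K by blast
  \<comment> \<open>Large enough for the tangent plane to lose at most half of the growth of \<open>s\<close>.\<close>
  define \<tau> where "\<tau> = 2 * norm (fderiv F x1) / \<alpha> + 1"
  have \<tau>: "\<tau> > 0" using \<alpha> by (simp add: \<tau>_def add_nonneg_pos)
  have ratio: "norm (fderiv F x1) / \<tau> \<le> \<alpha> / 2"
    using \<alpha> \<tau> by (simp add: pos_divide_le_eq \<tau>_def algebra_simps)
  define C where "C = F x1 - fderiv F x1 x1 - \<nu> * ln \<tau>"
  have lower: "C + \<alpha> / 2 * norm x \<le> F x + s x" if x: "x \<in> interior K" for x
  proof -
    have "F x1 + fderiv F x1 ((1 / \<tau>) *\<^sub>R x - x1) \<le> F ((1 / \<tau>) *\<^sub>R x)"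
      using \<tau> by (intro gradient_inequality x1 scaleR_interior x) simp
    also have "\<dots> = F x + \<nu> * ln \<tau>"
      using log_homogeneous[OF x, of "1 / \<tau>"] \<tau> by (simp add: ln_div)
    finally have 1: "C + fderiv F x1 x / \<tau> \<le> F x"
      by (simp add: C_def blinfun.bilinear_simps)
    have "\<bar>fderiv F x1 x / \<tau>\<bar> \<le> norm (fderiv F x1) / \<tau> * norm x"
      using norm_blinfun[of "fderiv F x1" x] \<tau> by (simp add: divide_right_mono)
    also have "\<dots> \<le> \<alpha> / 2 * norm x" using ratio by (intro mult_right_mono) auto
    finally have 2: "- (\<alpha> / 2 * norm x) \<le> fderiv F x1 x / \<tau>" by linarith
    have "\<alpha> * norm x \<le> s x" using \<alpha>(2) x interior_subset by blast
    with 1 2 show ?thesis by simp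
  qed
  define R where "R = F x1 + s x1"
  define S where "S = (\<lambda>x. (x, R - s x)) -` {(x, r). x \<in> interior K \<and> F x \<le> r}"
  have S_iff: "x \<in> S \<longleftrightarrow> x \<in> interior K \<and> F x + s x \<le> R" for x
    by (auto simp: S_def)
  have "closed S"
    unfolding S_def by (intro closed_vimage closed_epigraph continuous_intros)
  moreover have "bounded S"
    unfolding bounded_iff
  proof (intro exI ballI)
    fix x assume "x \<in> S"
    then have "C + \<alpha> / 2 * norm x \<le> R" using lower S_iff by fastforce
    then show "norm x \<le> (R - C) * 2 / \<alpha>" using \<alpha> by (simp add: field_simps)
  qed
  ultimately have "compact S" by (simp add: compact_eq_bounded_closed)
  moreover have "x1 \<in> S" using x1 by (simp add: S_iff R_def)
  moreover have "continuous_on S (\<lambda>x. F x + s x)"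
    by (intro continuous_intros continuous_on_subset[OF continuous_f]) (auto simp: S_iff)
  ultimately obtain x where x: "x \<in> S" "\<And>y. y \<in> S \<Longrightarrow> F x + s x \<le> F y + s y"
    using continuous_attains_inf[of S "\<lambda>x. F x + s x"] by blast
  have xI: "x \<in> interior K" using x by (simp add: S_iff)
  have min: "F x + s x \<le> F y + s y" if "y \<in> interior K" for y
    using x that by (cases "y \<in> S") (auto simp: S_iff)
  have "((\<lambda>x. F x + s x) has_derivative (\<lambda>h. fderiv F x h + s h)) (at x)"
    using deriv_f[OF xI] by (auto intro!: derivative_eq_intros)
  moreover have "\<forall>\<^sub>F y in at x. F x + s x \<le> F y + s y"
    using min xI eventually_at_in_open'[OF open_domain xI] by (auto elim: eventually_mono)
  ultimately have "(\<lambda>h. fderiv F x h + s h) = (\<lambda>h. 0)" by (rule has_derivative_local_min)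
  then have "fderiv F x h + s h = 0" for h by meson
  then have "- fderiv F x = s"
    by (intro blinfun_eqI) (metis add.inverse_unique uminus_blinfun.rep_eq)
  with xI show ?thesis by blast
qed

lemma dual_barrier_neg_gradient:
  assumes x: "x \<in> interior K"
  shows "dual_barrier K F (- fderiv F x) = fderiv F x x - F x"
  unfolding dual_barrier_def
proof (rule Greatest_equality)
  fix v assume "v \<in> (\<lambda>y. - (- fderiv F x) y - F y) ` interior K"
  then obtain y where "y \<in> interior K" "v = fderiv F x y - F y"
    by (auto simp: blinfun.bilinear_simps)
  then show "v \<le> fderiv F x x - F x"
    using gradient_inequality[OF x, of y] by (simp add: blinfun.bilinear_simps)
qed (use x in \<open>auto simp: blinfun.bilinear_simps\<close>)

text \<open>
  The maximiser in the definition of the dual barrier at \<open>s\<close>, written as the inverse of the map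
  \<open>x \<mapsto> - DF(x)\<close>, because its derivative comes from the inverse function theorem.
\<close>

definition dual_point :: "('a \<Rightarrow>\<^sub>L real) \<Rightarrow> 'a"
  where "dual_point = inv_into (interior K) (\<lambda>x. - fderiv F x)"

lemma dual_point_neg_gradient: "x \<in> interior K \<Longrightarrow> dual_point (- fderiv F x) = x"
  unfolding dual_point_def
  by (rule inv_into_f_f) (use inj_on_gradient in \<open>auto simp: inj_on_def\<close>)

lemma dual_point:
  assumes "s \<in> interior (dual_cone K)"
  shows dual_point_interior: "dual_point s \<in> interior K"
    and gradient_dual_point: "fderiv F (dual_point s) = - s"
  using gradient_attains_dual[OF assms] dual_point_neg_gradient by force+

lemma dual_point_scaleR:
  assumes s: "s \<in> interior (dual_cone K)" and \<tau>: "\<tau> > 0"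
  shows "dual_point (\<tau> *\<^sub>R s) = (1 / \<tau>) *\<^sub>R dual_point s"
proof -
  have "- fderiv F ((1 / \<tau>) *\<^sub>R dual_point s) = \<tau> *\<^sub>R s"
    using \<tau> by (simp add: gradient_scaleR dual_point[OF s])
  then show ?thesis
    using dual_point_neg_gradient[of "(1 / \<tau>) *\<^sub>R dual_point s"] \<tau>
    by (simp add: scaleR_interior dual_point_interior[OF s])
qed

definition inv_hessian :: "'a \<Rightarrow> ('a \<Rightarrow>\<^sub>L real) \<Rightarrow> 'a"
  where "inv_hessian x = inv (blinfun_apply (hessian F x))"

lemma hessian_inv_hessian: "x \<in> interior K \<Longrightarrow> hessian F x (inv_hessian x g) = g"
  using bij_hessian by (simp add: inv_hessian_def bij_is_surj surj_f_inv_f)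

lemma inv_hessian_eqI: "x \<in> interior K \<Longrightarrow> hessian F x u = g \<Longrightarrow> inv_hessian x g = u"
  using bij_hessian by (auto simp: inv_hessian_def bij_is_inj)

lemma linear_inv_hessian: "x \<in> interior K \<Longrightarrow> linear (inv_hessian x)"
  by (rule linearI; rule inv_hessian_eqI)
    (simp_all add: blinfun.bilinear_simps hessian_inv_hessian)

lemma inv_hessian_scaleR:
  assumes x: "x \<in> interior K" and \<tau>: "\<tau> > 0"
  shows "inv_hessian (\<tau> *\<^sub>R x) g = \<tau>\<^sup>2 *\<^sub>R inv_hessian x g"
  using \<tau> by (intro inv_hessian_eqI scaleR_interior x)
    (simp_all add: hessian_scaleR x hessian_inv_hessian blinfun.bilinear_simps)

lemma deriv_dual_point:
  assumes s: "s \<in> interior (dual_cone K)"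
  shows "(dual_point has_derivative (\<lambda>g. - inv_hessian (dual_point s) g)) (at s)"
proof -
  define x where "x = dual_point s"
  have x: "x \<in> interior K" "fderiv F x = - s" using dual_point[OF s] by (auto simp: x_def)
  have deriv: "((\<lambda>y. riesz (- fderiv F y)) has_derivative (\<lambda>h. riesz (- hessian F x h))) (at x)"
    by (intro bounded_linear.has_derivative[OF bounded_linear_riesz] has_derivative_minus 
        deriv_gradient x)
  have "((\<lambda>v. dual_point (blinfun_inner_right v)) has_derivative
      (\<lambda>v. - inv_hessian x (blinfun_inner_right v))) (at (riesz (- fderiv F x)))"
  proof (rule has_derivative_inverse_strong[OF open_domain x(1) _ _ deriv])
    show "continuous_on (interior K) (\<lambda>y. riesz (- fderiv F y))"
      by (intro bounded_linear.continuous_on[OF bounded_linear_riesz] continuous_intros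
          continuous_at_imp_continuous_on ballI has_derivative_continuous[OF deriv_gradient])
    show "(\<lambda>h. riesz (- hessian F x h)) \<circ> (\<lambda>v. - inv_hessian x (blinfun_inner_right v)) = id"
      by (simp add: fun_eq_iff blinfun.bilinear_simps hessian_inv_hessian x)
  qed (simp add: dual_point_neg_gradient)
  then have "((\<lambda>v. dual_point (blinfun_inner_right v)) has_derivative
      (\<lambda>v. - inv_hessian x (blinfun_inner_right v))) (at (riesz s))"
    by (simp add: x)
  from has_derivative_compose[OF bounded_linear_imp_has_derivative[OF bounded_linear_riesz] this]
  show ?thesis by (simp add: x_def)
qed

text \<open>
  The envelope formula: the terms with the derivative of the maximiser cancel by optimality.
\<close>

lemma deriv_dual_barrier:
  assumes s: "s \<in> interior (dual_cone K)"
  shows "(dual_barrier K F has_derivative to_bidual (- dual_point s)) (at s)"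
proof -
  let ?X' = "\<lambda>g. - inv_hessian (dual_point s) g"
  note X = deriv_dual_point[OF s]
  have "((\<lambda>s. s (dual_point s)) has_derivative (\<lambda>g. s (?X' g) + g (dual_point s))) (at s)"
    by (rule bounded_bilinear.FDERIV[OF bounded_bilinear_blinfun_apply has_derivative_ident X])
  moreover have "((\<lambda>s. F (dual_point s)) has_derivative (\<lambda>g. fderiv F (dual_point s) (?X' g))) (at s)"
    by (rule has_derivative_compose[OF X deriv_f[OF dual_point_interior[OF s]]])
  ultimately have "((\<lambda>s. - s (dual_point s) - F (dual_point s)) has_derivative 
     (\<lambda>g. - (s (?X' g) + g (dual_point s)) - fderiv F (dual_point s) (?X' g))) (at s)"
    by (intro has_derivative_diff has_derivative_minus)
  also have "(\<lambda>g. - (s (?X' g) + g (dual_point s)) - fderiv F (dual_point s) (?X' g))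
     = to_bidual (- dual_point s)"
    by (simp add: fun_eq_iff to_bidual.rep_eq gradient_dual_point[OF s] blinfun.bilinear_simps)
  finally show ?thesis
  proof (rule has_derivative_transform_within_open[OF _ open_interior s])
    fix s' assume "s' \<in> interior (dual_cone K)"
    from dual_point[OF this] dual_barrier_neg_gradient[of "dual_point s'"]
    show "- s' (dual_point s') - F (dual_point s') = dual_barrier K F s'"
      by (simp add: blinfun.bilinear_simps)
  qed
qed

lemma dual_grad_dual_barrier:
  assumes "s \<in> interior (dual_cone K)"
  shows "dual_grad (dual_barrier K F) s = - dual_point s"
  by (simp add: dual_grad_def fderiv_eqI[OF deriv_dual_barrier[OF assms]])

lemma dual_hessian_dual_barrier:
  assumes s: "s \<in> interior (dual_cone K)"
  shows "dual_hessian (dual_barrier K F) s g = inv_hessian (dual_point s) g"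
proof -
  have "((\<lambda>s. to_bidual (- dual_point s)) has_derivative
     (\<lambda>g. to_bidual (- (- inv_hessian (dual_point s) g)))) (at s)"
    by (rule bounded_linear.has_derivative[OF bounded_linear_to_bidual
          has_derivative_minus[OF deriv_dual_point[OF s]]])
  then have "(fderiv (dual_barrier K F) has_derivative
     (\<lambda>g. to_bidual (inv_hessian (dual_point s) g))) (at s)"
    unfolding minus_minus
    by (rule has_derivative_transform_within_open[OF _ open_interior s])
      (simp add: fderiv_eqI[OF deriv_dual_barrier])
  then show ?thesis by (simp add: dual_hessian_def fderiv_apply_eqI)
qed

section \<open>The barrier of the dual feasible set\<close>

lemma deriv_zeta:
  fixes A :: "'a \<Rightarrow> real ^ 'm"
  assumes A: "linear A" and y: "c - adj_map A y \<in> interior (dual_cone K)"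
  shows "(zeta K F A c has_derivative
    blinfun_inner_right (A (dual_point (c - adj_map A y)))) (at y)"
proof -
  have "((\<lambda>y. c - adj_map A y) has_derivative (\<lambda>d. 0 - adj_map A d)) (at y)"
    by (intro has_derivative_diff has_derivative_const
        bounded_linear_imp_has_derivative bounded_linear_adj_map A)
  from has_derivative_compose[OF this deriv_dual_barrier[OF y]]
  have "(zeta K F A c has_derivative
      (\<lambda>d. to_bidual (- dual_point (c - adj_map A y)) (0 - adj_map A d))) (at y)"
    by (simp add: zeta_def[abs_def])
  also have "(\<lambda>d. to_bidual (- dual_point (c - adj_map A y)) (0 - adj_map A d))
      = blinfun_inner_right (A (dual_point (c - adj_map A y)))"
    by (simp add: fun_eq_iff to_bidual.rep_eq blinfun.bilinear_simps adj_map_apply[OF A] inner_commute)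
  finally show ?thesis .
qed

lemma hessian_zeta:
  fixes A :: "'a \<Rightarrow> real ^ 'm"
  assumes A: "linear A" and y: "c - adj_map A y \<in> interior (dual_cone K)"
  shows "hessian (zeta K F A c) y d =
    blinfun_inner_right (A (inv_hessian (dual_point (c - adj_map A y)) (adj_map A d)))"
proof -
  let ?L = "\<lambda>d. blinfun_inner_right (A (inv_hessian (dual_point (c - adj_map A y)) (adj_map A d)))"
  let ?S = "(\<lambda>y. c - adj_map A y) -` interior (dual_cone K)"
  have "((\<lambda>y. c - adj_map A y) has_derivative (\<lambda>d. 0 - adj_map A d)) (at y)"
    by (intro has_derivative_diff has_derivative_const
        bounded_linear_imp_has_derivative bounded_linear_adj_map A)
  from has_derivative_compose[OF this deriv_dual_point[OF y]]
  have "((\<lambda>y. blinfun_inner_right (A (dual_point (c - adj_map A y)))) has_derivative 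
     (\<lambda>d. blinfun_inner_right (A (- inv_hessian (dual_point (c - adj_map A y)) (0 - adj_map A d))))) (at y)"
    using A by (intro bounded_linear.has_derivative[OF bounded_linear_blinfun_inner_right]
        bounded_linear.has_derivative[where f = A]) (auto simp: linear_conv_bounded_linear)
  moreover have "- inv_hessian (dual_point (c - adj_map A y)) (0 - adj_map A d)
      = inv_hessian (dual_point (c - adj_map A y)) (adj_map A d)" for d
    using linear_neg[OF linear_inv_hessian[OF dual_point_interior[OF y]]] by simp
  ultimately have "((\<lambda>y. blinfun_inner_right (A (dual_point (c - adj_map A y)))) has_derivative ?L) (at y)"
    by simp
  then have "(fderiv (zeta K F A c) has_derivative ?L) (at y)"
  proof (rule has_derivative_transform_within_open)
    show "open ?S"
      by (intro open_vimage open_interior continuous_intros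
          linear_continuous_on[OF bounded_linear_adj_map[OF A]])
  qed (use y in \<open>auto simp: fderiv_eqI[OF deriv_zeta[OF A]]\<close>)
  then show ?thesis by (rule fderiv_apply_eqI)
qed

lemma fderiv_psi:
  fixes A :: "'a \<Rightarrow> real ^ 'm"
  assumes A: "linear A" and y: "c - adj_map A y \<in> interior (dual_cone K)"
  shows "fderiv (psi K F A b c t) y =
    blinfun_inner_right (A (dual_point (c - adj_map A y)) - t *\<^sub>R b)"
proof (rule fderiv_eqI)
  have "((\<lambda>y. zeta K F A c y - t * (b \<bullet> y)) has_derivative
     (\<lambda>d. A (dual_point (c - adj_map A y)) \<bullet> d - t * (b \<bullet> d))) (at y)"
    using deriv_zeta[OF A y] by (auto intro!: derivative_eq_intros)
  also have "(\<lambda>d. A (dual_point (c - adj_map A y)) \<bullet> d - t * (b \<bullet> d))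
      = blinfun_inner_right (A (dual_point (c - adj_map A y)) - t *\<^sub>R b)"
    by (simp add: fun_eq_iff inner_diff_left)
  finally show "(psi K F A b c t has_derivative
     blinfun_inner_right (A (dual_point (c - adj_map A y)) - t *\<^sub>R b)) (at y)"
    by (simp add: psi_def[abs_def])
qed

text \<open>
  The Newton system \<open>\<nabla>\<^sup>2\<zeta>(y) d = \<nabla>\<psi>\<^sub>t(y)\<close> in primal terms. It is this equation that makes the gambit
  point satisfy \<open>A x = b\<close>. The operator \<open>\<nabla>\<^sup>2\<zeta>(y) = A [\<nabla>\<^sup>2F]\<^sup>-\<^sup>1 A\<^sup>*\<close> is definite since \<open>A\<^sup>*\<close> is injective.
\<close>

lemma gambit_direction_equation:
  fixes A :: "'a \<Rightarrow> real ^ 'm"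
  assumes A: "linear A" and inj: "inj (adj_map A)"
    and y: "c - adj_map A y \<in> interior (dual_cone K)"
  shows "A (inv_hessian (dual_point (c - adj_map A y)) (adj_map A (gambit_direction K F A b c t y)))
    = A (dual_point (c - adj_map A y)) - t *\<^sub>R b"
proof -
  let ?x = "dual_point (c - adj_map A y)"
  have x: "?x \<in> interior K" by (rule dual_point_interior[OF y])
  have "bij (blinfun_apply (hessian (zeta K F A c) y))"
  proof (rule positive_form_bij)
    fix d assume 0: "hessian (zeta K F A c) y d d = 0"
    define v where "v = inv_hessian ?x (adj_map A d)"
    have "hessian F ?x v v = hessian (zeta K F A c) y d d"
      by (simp add: v_def hessian_zeta[OF A y] hessian_inv_hessian[OF x] adj_map_apply[OF A] inner_commute)
    with 0 have "v = 0" using hessian_definite[OF x] by simp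
    then have "adj_map A d = 0" using hessian_inv_hessian[OF x, of "adj_map A d"] by (simp add: v_def)
    also have "0 = adj_map A 0"
      using bounded_linear_adj_map[OF A] by (simp add: linear_simps(3))
    finally show "d = 0" using inj by (simp add: inj_eq)
  qed
  then have "hessian (zeta K F A c) y (gambit_direction K F A b c t y) = fderiv (psi K F A b c t) y"
    by (simp add: gambit_direction_def bij_is_surj surj_f_inv_f)
  then have "riesz (hessian (zeta K F A c) y (gambit_direction K F A b c t y))
      = riesz (fderiv (psi K F A b c t) y)" by simp
  then show ?thesis by (simp add: hessian_zeta[OF A y] fderiv_psi[OF A y])
qed

end

text \<open>
  Membership of \<open>y\<close> in the interior of the feasible set alone does not place the slack in the interior
  of the dual cone (\<open>A\<close> may vanish). Prolonging the segment from a strictly feasible \<open>z\<close> beyond \<open>y\<close>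
  writes \<open>(1 + \<delta>)\<close> times the slack at \<open>y\<close> as an interior point of \<open>K\<^sup>*\<close> times \<open>\<delta>\<close> plus a point of
  \<open>K\<^sup>*\<close>.
\<close>

lemma slack_in_interior_dual_cone:
  fixes A :: "'a::euclidean_space \<Rightarrow> real ^ 'm"
  assumes A: "linear A" and K: "closed K" "cone K"
    and y: "y \<in> interior (feasible_y K A c)"
    and z: "c - adj_map A z \<in> interior (dual_cone K)"
  shows "c - adj_map A y \<in> interior (dual_cone K)"
proof -
  obtain e where e: "e > 0" "cball y e \<subseteq> feasible_y K A c"
    using y mem_interior_cball by blast
  define \<delta> where "\<delta> = e / (norm (y - z) + 1)"
  have n: "norm (y - z) + 1 > 0" by (simp add: add_nonneg_pos)
  have \<delta>: "\<delta> > 0" using e n by (simp add: \<delta>_def)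
  define w where "w = y + \<delta> *\<^sub>R (y - z)"
  have "norm (\<delta> *\<^sub>R (y - z)) \<le> \<delta> * (norm (y - z) + 1)"
    using \<delta> by simp
  also have "\<dots> = e" using n by (simp add: \<delta>_def)
  finally have "norm (\<delta> *\<^sub>R (y - z)) \<le> e" .
  then have "w \<in> cball y e" by (simp add: w_def dist_norm)
  then have w: "c - adj_map A w \<in> dual_cone K" using e by (auto simp: feasible_y_def)
  show ?thesis
  proof (rule interior_dual_coneI[OF K])
    fix x assume x: "x \<in> K" "x \<noteq> 0"
    obtain \<alpha> where \<alpha>: "\<alpha> > 0" "\<And>x. x \<in> K \<Longrightarrow> \<alpha> * norm x \<le> (c - adj_map A z) x"
      using interior_dual_cone_bound[OF z] by blast
    have "0 < \<alpha> * norm x" using \<alpha> x by simp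
    also have "\<dots> \<le> (c - adj_map A z) x" by (rule \<alpha>(2)[OF x(1)])
    finally have "0 < \<delta> * (c - adj_map A z) x + (c - adj_map A w) x"
      using w x \<delta> by (auto simp: dual_cone_def intro!: add_pos_nonneg)
    also have "\<dots> = (1 + \<delta>) * (c - adj_map A y) x"
      by (simp add: w_def blinfun.bilinear_simps adj_map_apply[OF A] algebra_simps inner_simps)
    finally show "0 < (c - adj_map A y) x"
      using \<delta> by (simp add: zero_less_mult_iff)
  qed
qed

section \<open>The gambit point is strictly feasible\<close>

theorem lemma6:
  fixes K :: "'a::euclidean_space set"
    and F :: "'a \<Rightarrow> real" and \<nu> :: real
    and A :: "'a \<Rightarrow> real ^ 'm" and b :: "real ^ 'm" and c :: "'a \<Rightarrow>\<^sub>L real"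
    and t \<beta> lam :: real
    and ybar dbar yhat :: "real ^ 'm"
    and sbar shat wbar :: "'a \<Rightarrow>\<^sub>L real"
    and xbar xhat :: 'a
  assumes "closed K" "convex K" "cone K" "pointed K" "interior K \<noteq> {}"
    and "normal_barrier K \<nu> F"
    and "linear A" "b \<noteq> 0"
    and "inj (\<lambda>(y, \<tau>::real). adj_map A y + \<tau> *\<^sub>R c)"
    and "\<exists>x y s. x \<in> interior K \<and> s \<in> interior (dual_cone K) \<and> A x = b \<and> s + adj_map A y = c"
    and "t > 0" "ybar \<in> interior (feasible_y K A c)"
    and "lam = newton_decrement K F A b c t ybar" "lam \<le> \<beta>" "\<beta> < 1"
    and "dbar = gambit_direction K F A b c t ybar"
    and "sbar = c - adj_map A ybar"
    and "xbar = - (1 / t) *\<^sub>R dual_grad (dual_barrier K F) sbar"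
    and "yhat = ybar + dbar"
    and "shat = c - adj_map A yhat"
    and "wbar = sqrt t *\<^sub>R sbar"
    and "xhat = dual_hessian (dual_barrier K F) wbar shat"
  shows "A xhat = b \<and>
    primal_local_norm F xbar (xhat - xbar) = lam \<and>
    dual_local_norm (dual_barrier K F) sbar (shat - sbar) = lam \<and>
    lam \<le> \<beta> \<and> \<beta> < 1 \<and>
    xhat \<in> interior K \<and> shat \<in> interior (dual_cone K) \<and>
    (xhat, yhat, shat) \<in> rint_feasible K A b c"
proof -
  interpret normal_cone_barrier K \<nu> F
    using assms(1-6) by unfold_locales
  note A = \<open>linear A\<close> and t = \<open>t > 0\<close>
  have inj: "inj (adj_map A)"
  proof (rule injI)
    fix y z assume "adj_map A y = adj_map A z"
    then show "y = z"
      using injD[OF assms(9), of "(y, 0)" "(z, 0)"] by simp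
  qed
  obtain z where "c - adj_map A z \<in> interior (dual_cone K)"
    using assms(10) by (metis add_diff_cancel_right')
  from slack_in_interior_dual_cone[OF A \<open>closed K\<close> \<open>cone K\<close> assms(12) this]
  have sbar: "c - adj_map A ybar \<in> interior (dual_cone K)" "sbar \<in> interior (dual_cone K)"
    by (simp_all add: \<open>sbar = _\<close>)
  define x where "x = dual_point sbar"
  have x: "x \<in> interior K" "fderiv F x = - sbar" using dual_point[OF sbar(2)] by (auto simp: x_def)
  define a where "a = adj_map A dbar"
  \<comment> \<open>All displacements are multiples of \<open>v = [\<nabla>\<^sup>2F(x)]\<^sup>-\<^sup>1 A\<^sup>* d\<close> in the primal and of its image \<open>a = A\<^sup>* d\<close>
      in the dual space, so both squared local lengths equal \<open>\<langle>a, v\<rangle>\<close>.\<close>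
  define v where "v = inv_hessian x a"
  have Hv: "hessian F x v = a" by (simp add: v_def hessian_inv_hessian x)
  have Av: "A v = A x - t *\<^sub>R b"
    using gambit_direction_equation[OF A inj sbar(1), of b t] assms(16,17)
    by (simp add: v_def a_def x_def)
  have shat: "shat = sbar - a"
    using bounded_linear_adj_map[OF A] assms(17,19,20) by (simp add: a_def linear_simps)
  have xbar: "xbar = (1 / t) *\<^sub>R x"
    using assms(18) by (simp add: dual_grad_dual_barrier[OF sbar(2)] x_def)
  have wbar: "wbar \<in> interior (dual_cone K)" "dual_point wbar = (1 / sqrt t) *\<^sub>R x"
    using t assms(21) by (simp_all add: scaleR_interior_cone cone_dual_cone sbar dual_point_scaleR x_def)
  \<comment> \<open>Euler's relation gives \<open>\<nabla>\<^sup>2F(x) x = sbar\<close>.\<close>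
  have "inv_hessian x shat = x - v"
    by (rule inv_hessian_eqI[OF x(1)])
      (simp add: shat blinfun.bilinear_simps Hv hessian_apply_self x)
  then have xhat: "xhat = (1 / t) *\<^sub>R (x - v)"
    using assms(22) t by (simp add: dual_hessian_dual_barrier wbar inv_hessian_scaleR x power_divide)
  have lam: "lam = sqrt (a v)"
  proof -
    have "fderiv (psi K F A b c t) ybar dbar = A v \<bullet> dbar"
      using fderiv_psi[OF A sbar(1), of b t] assms(17) by (simp add: Av x_def)
    also have "\<dots> = a v" by (simp add: a_def adj_map_apply[OF A] inner_commute)
    finally show ?thesis using assms(13,16) by (simp add: newton_decrement_def)
  qed
  have small: "a v < 1"
    using le_less_trans[OF assms(14,15)] by (simp add: lam)
  have diff: "xhat - xbar = - (1 / t) *\<^sub>R v"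
    by (simp add: xhat xbar algebra_simps)
  have xbarI: "xbar \<in> interior K" unfolding xbar using t by (intro scaleR_interior x) simp
  have Hdiff: "hessian F xbar (xhat - xbar) (xhat - xbar) = a v"
    unfolding diff unfolding xbar using t
    by (simp add: hessian_scaleR x blinfun.bilinear_simps Hv power2_eq_square)
  have primal: "primal_local_norm F xbar (xhat - xbar) = lam"
    by (simp add: primal_local_norm_def Hdiff lam)
  have "inv_hessian x (- a) = - v"
    by (rule inv_hessian_eqI[OF x(1)]) (simp add: blinfun.bilinear_simps Hv)
  then have dual: "dual_local_norm (dual_barrier K F) sbar (shat - sbar) = lam"
    by (simp add: dual_local_norm_def dual_hessian_dual_barrier sbar shat lam
        blinfun.bilinear_simps flip: x_def)
  have xhatI: "xhat \<in> interior K"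
    using Dikin_ellipsoid[OF xbarI, of "xhat - xbar"] Hdiff small by simp
  have shatI: "shat \<in> interior (dual_cone K)"
    using dual_Dikin_ellipsoid[OF x(1), of "- v"] small
    by (simp add: blinfun.bilinear_simps Hv x shat)
  have "A (x - v) = t *\<^sub>R b" by (simp add: linear_diff[OF A] Av)
  then have Axhat: "A xhat = b" using t by (simp add: xhat linear_cmul[OF A])
  have "(xhat, yhat, shat) \<in> rint_feasible K A b c"
    using xhatI shatI interior_subset[of K] interior_subset[of "dual_cone K"] Axhat assms(20)
    by (auto simp: rint_feasible_def feasible_def primal_feasible_def dual_feasible_def)
  with primal dual xhatI shatI Axhat assms(14,15) show ?thesis by simp
qed

end
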